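(* For every integer $n\ge0$, the inverse Kazhdan--Lusztig polynomial of the thagomizer matroid $T_n$ is $$Q_{T_n}(t)=\sum_{k=0}^{\lfloor n/2\rfloor}\ \sum_{i=2k}^{n}\frac{n-i+1}{n+1}\binom{n+1}{k,\ i-2k,\ n+k-i+1}t^k ,$$ where $\binom{n+1}{a,b,c}=\frac{(n+1)!}{a!\,b!\,c!}$ is a multinomial coefficient.
   Context: The thagomizer matroid $T_n$ is the graphic matroid of $K_{1,1,n}$ (vertices $A,B,1,\dots,n$, edges $AB,Aj,Bj$ for $1\le j\le n$). For a loopless matroid $\mathrm M$ with lattice of flats $\mathcal L(\mathrm M)$, characteristic polynomial $\chi_{\mathrm M}(t)$, restriction $\mathrm M|_F$ and contraction $\mathrm M/F$, the inverse Kazhdan--Lusztig polynomial $Q_{\mathrm M}(t)\in\mathbb Z[t]$ is the unique polynomial with: $Q_{\mathrm M}=1$ if $\operatorname{rk}\mathrm M=0$; $\deg Q_{\mathrm M}<\tfrac12\operatorname{rk}\mathrm M$ if $\operatorname{rk}\mathrm M>0$; and $t^{\operatorname{rk}\mathrm M}(-1)^{\operatorname{rk}\mathrm M}Q_{\mathrm M}(t^{-1})=\sum_{F\in\mathcal L(\mathrm M)}(-1)^{\operatorname{rk}\mathrm M|_F}Q_{\mathrm M|_F}(t)\,t^{\operatorname{rk}\mathrm M/F}\chi_{\mathrm M/F}(t^{-1})$. *)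

theory Defs
  imports Complex_Main "HOL-Computational_Algebra.Polynomial"
begin

text \<open>The record only carries the data (ground set, independent sets); the notions below agree with
  the usual ones for finite ground sets and independent sets satisfying the matroid axioms.\<close>

record 'a matroid =
  ground :: "'a set"
  indep :: "'a set set"

definition rk :: "'a matroid \<Rightarrow> nat" where
  "rk M = Max (card ` indep M)"

definition restriction :: "'a matroid \<Rightarrow> 'a set \<Rightarrow> 'a matroid" where
  "restriction M F = \<lparr>ground = F, indep = {I \<in> indep M. I \<subseteq> F}\<rparr>"

definition bases :: "'a matroid \<Rightarrow> 'a set set" where
  "bases M = {B \<in> indep M. \<forall>I \<in> indep M. B \<subseteq> I \<longrightarrow> I = B}"

definition contraction :: "'a matroid \<Rightarrow> 'a set \<Rightarrow> 'a matroid" where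
  "contraction M F = \<lparr>ground = ground M - F,
     indep = {I. I \<subseteq> ground M - F \<and> (\<exists>B \<in> bases (restriction M F). I \<union> B \<in> indep M)}\<rparr>"

definition flats :: "'a matroid \<Rightarrow> 'a set set" where
  "flats M = {F. F \<subseteq> ground M \<and>
     (\<forall>x \<in> ground M - F. rk (restriction M F) < rk (restriction M (insert x F)))}"

text \<open>The Moebius function of a family \<open>L\<close> of finite sets, ordered by inclusion.\<close>

function moebius :: "'a set set \<Rightarrow> 'a set \<Rightarrow> 'a set \<Rightarrow> int" where
  "moebius L X Y =
     (if X = Y then (if X \<in> L then 1 else 0)
      else if X \<subset> Y \<and> finite Y
        then - (\<Sum>Z \<in> {Z \<in> L. X \<subseteq> Z \<and> Z \<subset> Y}. moebius L X Z)
      else 0)"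
  by pat_completeness auto
termination
  by (relation "measure (\<lambda>(L, X, Y). card Y)") (auto intro: psubset_card_mono)

declare moebius.simps [simp del]

text \<open>In a loopless matroid the least flat is the empty set. If there are loops, the empty set
  is not a flat and the formula gives the usual value 0.\<close>

definition char_poly :: "'a matroid \<Rightarrow> int poly" where
  "char_poly M = (\<Sum>F \<in> flats M. monom (moebius (flats M) {} F) (rk M - rk (restriction M F)))"

text \<open>For a polynomial \<open>p\<close> of degree at most \<open>r\<close>, \<open>reversal r p\<close> is \<open>t\<^sup>r p(t\<^sup>-\<^sup>1)\<close>.\<close>

definition reversal :: "nat \<Rightarrow> 'a::comm_semiring_1 poly \<Rightarrow> 'a poly" where
  "reversal r p = monom 1 (r - degree p) * reflect_poly p"

lemma poly_reversal:
  fixes p :: "'a::field poly"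
  assumes "degree p \<le> r" "t \<noteq> 0"
  shows "poly (reversal r p) t = t ^ r * poly p (inverse t)"
  using assms
  by (simp add: reversal_def poly_monom poly_reflect_poly_nz mult.assoc [symmetric]
      flip: power_add)

lemma coeff_reversal:
  assumes "degree p \<le> r"
  shows "coeff (reversal r p) i = (if i \<le> r then coeff p (r - i) else 0)"
  using assms
  by (auto simp: reversal_def coeff_monom_mult coeff_reflect_poly coeff_eq_0 not_less)

lemma reversal_diff_unique:
  fixes p q :: "int poly"
  assumes "2 * degree p < r" "2 * degree q < r" "reversal r p - p = reversal r q - q"
  shows "p = q"
proof (rule poly_eqI)
  fix i
  show "coeff p i = coeff q i"
  proof (cases "2 * i < r")
    case True
    then have "coeff p (r - i) = 0" "coeff q (r - i) = 0"
      using assms by (auto intro!: coeff_eq_0)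
    moreover have "coeff (reversal r p - p) (r - i) = coeff (reversal r q - q) (r - i)"
      by (simp only: assms(3))
    ultimately show ?thesis
      using True assms(1,2) by (simp add: coeff_reversal)
  next
    case False
    then show ?thesis using assms by (simp add: coeff_eq_0)
  qed
qed

text \<open>The flat \<open>F = ground M\<close> contributes the unknown polynomial \<open>q\<close> itself to the right-hand
  side of the defining identity; all other flats are proper subsets of the ground set. The value
  for an infinite ground set is irrelevant and only ensures termination. The description below has at most one solution by
  \<open>reversal_diff_unique\<close>.\<close>

function inverse_KL :: "'a matroid \<Rightarrow> int poly" where
  "inverse_KL M =
     (if infinite (ground M) then 0
      else if rk M = 0 then 1
      else (THE q. 2 * degree q < rk M \<and>
        (-1) ^ rk M * reversal (rk M) q =
        (\<Sum>F \<in> flats M. (-1) ^ rk (restriction M F)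
           * (if F = ground M then q else inverse_KL (restriction M F))
           * reversal (rk (contraction M F)) (char_poly (contraction M F)))))"
  by pat_completeness auto
termination
  by (relation "measure (\<lambda>M. card (ground M))")
     (auto simp: restriction_def flats_def intro!: psubset_card_mono)

declare inverse_KL.simps [simp del]

text \<open>A simple graph is given by its set of edges, each edge being the set of its two ends; a
  cycle is given by the cyclic sequence of its (distinct) vertices.\<close>

definition cycle_edges :: "'v list \<Rightarrow> 'v set set" where
  "cycle_edges vs = {{vs ! i, vs ! (Suc i mod length vs)} | i. i < length vs}"

definition forest :: "'v set set \<Rightarrow> bool" where
  "forest S \<longleftrightarrow> \<not> (\<exists>vs. 3 \<le> length vs \<and> distinct vs \<and> cycle_edges vs \<subseteq> S)"

definition graphic_matroid :: "'v set set \<Rightarrow> 'v set matroid" where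
  "graphic_matroid E = \<lparr>ground = E, indep = {S. S \<subseteq> E \<and> forest S}\<rparr>"

datatype thag_vertex = A | B | Spike nat

definition thagomizer_graph :: "nat \<Rightarrow> thag_vertex set set" where
  "thagomizer_graph n =
     {{A, B}} \<union> (\<lambda>j. {A, Spike j}) ` {1..n} \<union> (\<lambda>j. {B, Spike j}) ` {1..n}"

definition thagomizer :: "nat \<Rightarrow> thag_vertex set matroid" where
  "thagomizer n = graphic_matroid (thagomizer_graph n)"

end

theory Submission
  imports Defs
begin

text \<open>
  A flat of the thagomizer matroid with spike set \<open>S\<close> either contains the edge \<open>AB\<close> and is then the
  thagomizer on a subset \<open>T\<close> of the spikes, or it is an independent set of spike edges with at most
  one edge at each spike, given by disjoint sets \<open>P\<close>, \<open>Q\<close> of spikes joined to \<open>A\<close> and to \<open>B\<close>. In the first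
  case the contraction has the characteristic polynomial of a Boolean matroid, in the second case
  that of a smaller thagomizer, and a Boolean matroid has inverse Kazhdan--Lusztig polynomial 1. Writing \<open>Q\<^sub>S\<close>
  for the polynomial in question and \<open>n = |S|\<close>, the defining identity becomes
  \<open>t\<^bsup>n+1\<^esup> Q\<^sub>S(1/t) = (\<Sum>T\<subseteq>S. (t - 1)\<^bsup>n-|T|\<^esup> Q\<^sub>T(t)) + (t - 1) (1 + 2t)\<^bsup>n\<^esup>\<close>.
  The binomial transform \<open>Q\<^sub>S = (\<Sum>U\<subseteq>S. R\<^bsub>|U|\<^esub>)\<close> simplifies it to
  \<open>R\<^sub>u(t) - t\<^bsup>u+1\<^esup> R\<^sub>u(1/t) = (1 - t) (1 + t)\<^bsup>u\<^esup>\<close>. The right-hand side is antipalindromic, so \<open>R\<^sub>u\<close> is its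
  lower half, whose coefficients are the ballot numbers; multiplied by binomial coefficients they
  are the multinomial expression of the theorem.
\<close>

section \<open>Finite matroids\<close>

text \<open>Characteristic polynomials have coranks as exponents; reversal turns these into ranks.
  The bound \<open>d i \<le> r\<close> keeps \<open>r - d i\<close> from truncating.\<close>

lemma reversal_sum_monom:
  fixes c :: "'b \<Rightarrow> 'a::comm_semiring_1"
  assumes "finite I" "\<And>i. i \<in> I \<Longrightarrow> d i \<le> r"
  shows "reversal r (\<Sum>i\<in>I. monom (c i) (r - d i)) = (\<Sum>i\<in>I. monom (c i) (d i))"
proof (rule poly_eqI)
  fix k
  have "degree (\<Sum>i\<in>I. monom (c i) (r - d i)) \<le> r"
    by (intro degree_sum_le assms) (meson degree_monom_le diff_le_self order_trans)
  then have "coeff (reversal r (\<Sum>i\<in>I. monom (c i) (r - d i))) k =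
      (if k \<le> r then \<Sum>i\<in>I. if r - d i = r - k then c i else 0 else 0)"
    by (simp add: coeff_reversal coeff_sum)
  also have "\<dots> = (\<Sum>i\<in>I. if d i = k then c i else 0)"
  proof (cases "k \<le> r")
    case True
    have "(r - d i = r - k) = (d i = k)" if "i \<in> I" for i
      using assms(2)[OF that] True by linarith
    then show ?thesis using True by (auto intro!: sum.cong)
  next
    case False
    then have "d i \<noteq> k" if "i \<in> I" for i using assms(2)[OF that] by auto
    then show ?thesis using False by simp
  qed
  finally show "coeff (reversal r (\<Sum>i\<in>I. monom (c i) (r - d i))) k =
      coeff (\<Sum>i\<in>I. monom (c i) (d i)) k"
    by (simp add: coeff_sum)
qed

text \<open>Vanishing interval sums are the recursion of the Moebius function solved for its last
  term, so a guessed closed form \<open>g\<close> only has to be summed over intervals.\<close>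

lemma moebius_eqI:
  assumes "X \<in> L" "g X = 1"
    and zero: "\<And>Y. Y \<in> L \<Longrightarrow> X \<subset> Y \<Longrightarrow> (\<Sum>Z \<in> {Z \<in> L. X \<subseteq> Z \<and> Z \<subseteq> Y}. g Z) = 0"
    and "finite Y" "Y \<in> L" "X \<subseteq> Y"
  shows "moebius L X Y = g Y"
  using assms(4-6)
proof (induction Y rule: finite_psubset_induct)
  case (psubset Y)
  show ?case
  proof (cases "X = Y")
    case True
    then show ?thesis using assms by (simp add: moebius.simps)
  next
    case False
    then have "X \<subset> Y" using psubset by blast
    have "{Z \<in> L. X \<subseteq> Z \<and> Z \<subseteq> Y} = insert Y {Z \<in> L. X \<subseteq> Z \<and> Z \<subset> Y}"
      using psubset by auto
    moreover have "finite {Z \<in> L. X \<subseteq> Z \<and> Z \<subset> Y}"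
      by (rule finite_subset[of _ "Pow Y"]) (use psubset in auto)
    ultimately have "(\<Sum>Z \<in> {Z \<in> L. X \<subseteq> Z \<and> Z \<subset> Y}. g Z) = - g Y"
      using zero[OF psubset.prems(1) \<open>X \<subset> Y\<close>] by simp
    moreover have "(\<Sum>Z \<in> {Z \<in> L. X \<subseteq> Z \<and> Z \<subset> Y}. moebius L X Z) =
        (\<Sum>Z \<in> {Z \<in> L. X \<subseteq> Z \<and> Z \<subset> Y}. g Z)"
      by (intro sum.cong) (use psubset.IH in auto)
    ultimately show ?thesis
      using False \<open>X \<subset> Y\<close> psubset.hyps by (subst moebius.simps) simp
  qed
qed

text \<open>The axioms that the bare record leaves out. Boolean and thagomizer matroids are both
  instances, so the recursion for \<open>inverse_KL\<close> is analysed once for both.\<close>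

locale finite_matroid =
  fixes M :: "'a matroid"
  assumes finite_ground: "finite (ground M)"
    and indep_subset: "I \<in> indep M \<Longrightarrow> I \<subseteq> ground M"
    and empty_indep: "{} \<in> indep M"
    and indep_mono: "I \<in> indep M \<Longrightarrow> J \<subseteq> I \<Longrightarrow> J \<in> indep M"
    and augment: "I \<in> indep M \<Longrightarrow> J \<in> indep M \<Longrightarrow> card I < card J \<Longrightarrow>
      \<exists>x \<in> J - I. insert x I \<in> indep M"
begin

section \<open>Rank, bases and contraction\<close>

abbreviation r :: "'a set \<Rightarrow> nat" where
  "r X \<equiv> rk (restriction M X)"

lemma finite_indep: "I \<in> indep M \<Longrightarrow> finite I"
  using indep_subset finite_ground finite_subset by blast

lemma finite_Indep: "finite (indep M)"
  by (rule finite_subset[of _ "Pow (ground M)"]) (use indep_subset finite_ground in auto)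

lemma r_eq_Max: "r X = Max (card ` {I \<in> indep M. I \<subseteq> X})"
  by (simp add: rk_def restriction_def)

lemma card_le_r: "I \<in> indep M \<Longrightarrow> I \<subseteq> X \<Longrightarrow> card I \<le> r X"
  unfolding r_eq_Max by (rule Max_ge) (use finite_Indep in auto)

lemma r_attained: obtains I where "I \<in> indep M" "I \<subseteq> X" "card I = r X"
proof -
  have "r X \<in> card ` {I \<in> indep M. I \<subseteq> X}"
    unfolding r_eq_Max by (rule Max_in) (use finite_Indep empty_indep in auto)
  then show ?thesis using that by auto
qed

lemma r_mono: "X \<subseteq> Y \<Longrightarrow> r X \<le> r Y"
  by (rule r_attained[of X]) (metis card_le_r order_trans)

lemma rk_eq_r: "rk M = r (ground M)"
proof -
  have "{I \<in> indep M. I \<subseteq> ground M} = indep M" using indep_subset by auto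
  then show ?thesis by (simp add: r_eq_Max) (simp add: rk_def)
qed

text \<open>A largest independent set between \<open>I\<close> and \<open>X\<close> that fell short
  of \<open>r X\<close> could be augmented from an independent subset of \<open>X\<close> of size
  \<open>r X\<close>.\<close>

lemma indep_extend:
  assumes "I \<in> indep M" "I \<subseteq> X"
  obtains J where "J \<in> indep M" "I \<subseteq> J" "J \<subseteq> X" "card J = r X"
proof -
  let ?C = "{J \<in> indep M. I \<subseteq> J \<and> J \<subseteq> X}"
  have "finite ?C" "?C \<noteq> {}" using finite_Indep assms by auto
  then have "Max (card ` ?C) \<in> card ` ?C" by (intro Max_in) auto
  then obtain J where J: "J \<in> ?C" and Jmax: "Max (card ` ?C) = card J" by (rule imageE)
  have max: "card K \<le> card J" if "K \<in> ?C" for K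
    unfolding Jmax[symmetric] using that \<open>finite ?C\<close> by (intro Max_ge) auto
  have "card J = r X"
  proof (rule ccontr)
    assume "card J \<noteq> r X"
    with J have "card J < r X" using card_le_r by (simp add: le_neq_implies_less)
    moreover obtain K where K: "K \<in> indep M" "K \<subseteq> X" "card K = r X" by (rule r_attained)
    ultimately obtain x where x: "x \<in> K - J" "insert x J \<in> indep M" using augment J by force
    then have "insert x J \<in> ?C" using J K by auto
    from max[OF this] show False using x J finite_indep by simp
  qed
  then show ?thesis using that J by auto
qed

lemma bases_restriction: "bases (restriction M F) = {X \<in> indep M. X \<subseteq> F \<and> card X = r F}"
proof (intro set_eqI iffI)
  fix X assume X: "X \<in> bases (restriction M F)"
  then have "X \<in> indep M" "X \<subseteq> F" by (auto simp: bases_def restriction_def)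
  then obtain J where J: "J \<in> indep M" "X \<subseteq> J" "J \<subseteq> F" "card J = r F" by (rule indep_extend)
  with X have "J = X" by (simp add: bases_def restriction_def)
  with J show "X \<in> {X \<in> indep M. X \<subseteq> F \<and> card X = r F}" by simp
next
  fix X assume X: "X \<in> {X \<in> indep M. X \<subseteq> F \<and> card X = r F}"
  have "I = X" if "I \<in> indep M" "I \<subseteq> F" "X \<subseteq> I" for I
    using that X card_le_r[OF that(1,2)] card_seteq[OF finite_indep[OF that(1)] that(3)] by simp
  with X show "X \<in> bases (restriction M F)" by (auto simp: bases_def restriction_def)
qed

text \<open>Adding a basis of \<open>F\<close> to an independent set of the contraction gives the
  upper bound; for the lower bound a basis of \<open>F\<close> is extended to one of
  \<open>X \<union> F\<close>.\<close>

lemma rk_restriction_contraction: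
  assumes "F \<subseteq> ground M" "X \<subseteq> ground M - F"
  shows "rk (restriction (contraction M F) X) = r (X \<union> F) - r F"
proof -
  let ?N = "{I. I \<subseteq> ground M - F \<and> (\<exists>B \<in> bases (restriction M F). I \<union> B \<in> indep M) \<and> I \<subseteq> X}"
  have eq: "rk (restriction (contraction M F) X) = Max (card ` ?N)"
    by (simp add: rk_def restriction_def contraction_def)
  show ?thesis unfolding eq
  proof (rule Max_eqI)
    have "?N \<subseteq> Pow (ground M)" by auto
    then show "finite (card ` ?N)"
      using finite_ground by (meson finite_Pow_iff finite_imageI finite_subset)
  next
    fix y assume "y \<in> card ` ?N"
    then obtain I B where I: "y = card I" "I \<subseteq> ground M - F" "I \<subseteq> X"
      and B: "B \<in> bases (restriction M F)" "I \<union> B \<in> indep M" by auto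
    have "card (I \<union> B) \<le> r (X \<union> F)"
      using B I by (intro card_le_r) (auto simp: bases_restriction)
    moreover have "card (I \<union> B) = card I + r F"
      using B I finite_indep[OF B(2)]
      by (subst card_Un_disjoint) (auto simp: bases_restriction)
    ultimately show "y \<le> r (X \<union> F) - r F" using I by simp
  next
    obtain B where B: "B \<in> indep M" "B \<subseteq> F" "card B = r F" by (rule r_attained)
    then have "B \<subseteq> X \<union> F" by auto
    with B(1) obtain J where J: "J \<in> indep M" "B \<subseteq> J" "J \<subseteq> X \<union> F" "card J = r (X \<union> F)"
      by (rule indep_extend)
    \<comment> \<open>\<open>J \<inter> F\<close> contains the basis \<open>B\<close> of
      \<open>F\<close> and cannot be larger, so all elements that \<open>J\<close> adds to
      \<open>B\<close> lie in \<open>X\<close>.\<close>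
    have "J \<inter> F \<in> indep M" using J indep_mono by blast
    then have "card (J \<inter> F) \<le> card B" using B card_le_r by simp
    then have "B = J \<inter> F"
      using B J by (intro card_seteq) (auto intro: finite_indep finite_subset)
    then have "J - B \<subseteq> X" "J - B \<union> B = J" using J by auto
    then have "J - B \<in> ?N" using assms B J by (auto simp: bases_restriction intro!: bexI[of _ B])
    moreover have "card (J - B) = r (X \<union> F) - r F"
      using B J finite_indep by (simp add: card_Diff_subset)
    ultimately show "r (X \<union> F) - r F \<in> card ` ?N" by (intro image_eqI[of _ _ "J - B"]) simp_all
  qed
qed

lemma rk_contraction:
  assumes "F \<subseteq> ground M"
  shows "rk (contraction M F) = rk M - r F"
proof -
  have "rk (contraction M F) = rk (restriction (contraction M F) (ground M - F))"
    unfolding rk_def restriction_def contraction_def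
    by (rule arg_cong[where f = "\<lambda>S. Max (card ` S)"]) auto
  also have "\<dots> = r (ground M - F \<union> F) - r F"
    using assms by (rule rk_restriction_contraction) auto
  also have "ground M - F \<union> F = ground M" using assms by auto
  finally show ?thesis by (simp add: rk_eq_r)
qed

text \<open>Ranks in the contraction are ranks of sets united with \<open>F\<close>, lowered by the
  constant \<open>r F\<close>, so an element raises the rank there exactly when it does in
  \<open>M\<close>.\<close>

lemma flats_contraction:
  assumes "F \<subseteq> ground M"
  shows "flats (contraction M F) = (\<lambda>G. G - F) ` {G \<in> flats M. F \<subseteq> G}"
proof -
  have *: "H \<in> flats (contraction M F) \<longleftrightarrow> H \<union> F \<in> flats M" if H: "H \<subseteq> ground M - F" for H
  proof -
    have "rk (restriction (contraction M F) H) < rk (restriction (contraction M F) (insert x H))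
        \<longleftrightarrow> r (H \<union> F) < r (insert x (H \<union> F))" if "x \<in> ground M - F - H" for x
      using that H assms r_mono[of F "H \<union> F"] r_mono[of F "insert x (H \<union> F)"]
      by (subst (1 2) rk_restriction_contraction) auto
    moreover have "ground M - F - H = ground M - (H \<union> F)" by auto
    moreover have "ground (contraction M F) = ground M - F" by (simp add: contraction_def)
    ultimately show ?thesis using H assms unfolding flats_def by auto
  qed
  show ?thesis
  proof (intro set_eqI iffI)
    fix H assume H: "H \<in> flats (contraction M F)"
    then have "H \<subseteq> ground M - F" by (auto simp: flats_def contraction_def)
    then show "H \<in> (\<lambda>G. G - F) ` {G \<in> flats M. F \<subseteq> G}"
      using H * by (intro image_eqI[of _ _ "H \<union> F"]) auto
  next
    fix H assume "H \<in> (\<lambda>G. G - F) ` {G \<in> flats M. F \<subseteq> G}"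
    then obtain G where G: "H = G - F" "G \<in> flats M" "F \<subseteq> G" by auto
    then have "H \<subseteq> ground M - F" "H \<union> F = G" by (auto simp: flats_def)
    then show "H \<in> flats (contraction M F)" using * G by simp
  qed
qed

section \<open>Reversed characteristic polynomials of contractions, and uniqueness\<close>

lemma flat_subset: "F \<in> flats M \<Longrightarrow> F \<subseteq> ground M"
  by (simp add: flats_def)

lemma finite_flats: "finite (flats M)"
  by (rule finite_subset[of _ "Pow (ground M)"]) (use flat_subset finite_ground in auto)

lemma ground_flat: "ground M \<in> flats M"
  by (simp add: flats_def)

text \<open>Removing \<open>F\<close> identifies the interval of flats above \<open>F\<close> with
  the flats of the contraction, so everything can be read off from \<open>M\<close> once
  \<open>g\<close> is checked on that interval.\<close>

lemma reversal_char_poly_contraction: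
  assumes F: "F \<in> flats M" and "g F = 1"
    and zero: "\<And>G. G \<in> flats M \<Longrightarrow> F \<subset> G \<Longrightarrow> (\<Sum>H \<in> {H \<in> flats M. F \<subseteq> H \<and> H \<subseteq> G}. g H) = 0"
  shows "reversal (rk (contraction M F)) (char_poly (contraction M F)) =
    (\<Sum>G \<in> {G \<in> flats M. F \<subseteq> G}. monom (g G) (r G - r F))"
proof -
  let ?C = "contraction M F" and ?\<G> = "{G \<in> flats M. F \<subseteq> G}"
  have FE: "F \<subseteq> ground M" using F by (rule flat_subset)
  have inj: "inj_on (\<lambda>G. G - F) {G. F \<subseteq> G}" by (auto simp: inj_on_def)
  note fl = flats_contraction[OF FE]
  have moeb: "moebius (flats ?C) {} (G - F) = g G" if G: "G \<in> ?\<G>" for G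
  proof -
    have "moebius (flats ?C) {} (G - F) = g (G - F \<union> F)"
    \<comment> \<open>\<open>g\<close> lives on flats of \<open>M\<close>; it is carried to the
      contraction by uniting with \<open>F\<close>, the inverse of removing
      \<open>F\<close>.\<close>
    proof (rule moebius_eqI[where g = "\<lambda>H. g (H \<union> F)"])
      show "{} \<in> flats ?C" unfolding fl using F by force
      show "g ({} \<union> F) = 1" using assms by simp
      show "finite (G - F)"
        using G flat_subset[of G] finite_subset[OF _ finite_ground] by auto
      show "G - F \<in> flats ?C" unfolding fl using G by auto
      fix Y assume Y: "Y \<in> flats ?C" "{} \<subset> Y"
      then obtain K where K: "Y = K - F" "K \<in> flats M" "F \<subseteq> K" unfolding fl by auto
      have "{Z \<in> flats ?C. {} \<subseteq> Z \<and> Z \<subseteq> Y} =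
          (\<lambda>G. G - F) ` {H \<in> flats M. F \<subseteq> H \<and> H \<subseteq> K}"
        unfolding fl K using K(3) by auto
      then have "(\<Sum>Z \<in> {Z \<in> flats ?C. {} \<subseteq> Z \<and> Z \<subseteq> Y}. g (Z \<union> F)) =
          (\<Sum>H \<in> {H \<in> flats M. F \<subseteq> H \<and> H \<subseteq> K}. g (H - F \<union> F))"
        by (simp only:) (subst sum.reindex, auto intro: inj_on_subset[OF inj])
      also have "\<dots> = (\<Sum>H \<in> {H \<in> flats M. F \<subseteq> H \<and> H \<subseteq> K}. g H)"
        by (intro sum.cong refl arg_cong[where f = g]) auto
      also have "\<dots> = 0" using K Y by (intro zero) auto
      finally show "(\<Sum>Z \<in> {Z \<in> flats ?C. {} \<subseteq> Z \<and> Z \<subseteq> Y}. g (Z \<union> F)) = 0" .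
    qed simp
    also have "G - F \<union> F = G" using G by auto
    finally show ?thesis .
  qed
  have rank: "rk (restriction ?C (G - F)) = r G - r F" if G: "G \<in> ?\<G>" for G
  proof -
    have "G - F \<union> F = G" "G - F \<subseteq> ground M - F" using G flat_subset by auto
    then show ?thesis using rk_restriction_contraction[OF FE] by metis
  qed
  have "char_poly ?C = (\<Sum>G\<in>?\<G>. monom (moebius (flats ?C) {} (G - F))
      (rk ?C - rk (restriction ?C (G - F))))"
    unfolding char_poly_def by (subst (1) fl, subst sum.reindex)
      (auto intro: inj_on_subset[OF inj])
  also have "\<dots> = (\<Sum>G\<in>?\<G>. monom (g G) (rk ?C - (r G - r F)))"
    by (intro sum.cong refl) (simp add: moeb rank)
  finally show ?thesis
    using finite_flats flat_subset
    by (simp only:, intro reversal_sum_monom)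
      (simp_all add: rk_contraction[OF FE] rk_eq_r r_mono diff_le_mono)
qed

text \<open>The weight of the top flat, by which the unknown enters the right side of the defining
  identity with a mere sign.\<close>

lemma reversal_char_poly_contraction_ground:
  "reversal (rk (contraction M (ground M))) (char_poly (contraction M (ground M))) = 1"
proof -
  have "{G \<in> flats M. ground M \<subseteq> G} = {ground M}" using ground_flat flat_subset by blast
  then show ?thesis
    using flat_subset
    by (subst reversal_char_poly_contraction[where g = "\<lambda>_. 1"]) (auto simp: ground_flat)
qed

text \<open>Once the term of \<open>ground M\<close> is moved to the left,
  \<open>reversal (rk M) q - q\<close> is, up to sign, determined by proper restrictions. By
  \<open>reversal_diff_unique\<close> this determines \<open>q\<close>, so \<open>THE\<close>
  returns any candidate that passes the test.\<close>

lemma inverse_KL_eqI: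
  assumes "rk M \<noteq> 0" and deg: "2 * degree q < rk M"
    and eq: "(-1) ^ rk M * reversal (rk M) q =
      (\<Sum>F \<in> flats M. (-1) ^ r F * (if F = ground M then q else inverse_KL (restriction M F))
         * reversal (rk (contraction M F)) (char_poly (contraction M F)))"
  shows "inverse_KL M = q"
proof -
  define rest where "rest = (\<Sum>F \<in> flats M - {ground M}. (-1) ^ r F * inverse_KL (restriction M F)
         * reversal (rk (contraction M F)) (char_poly (contraction M F)))"
  have split: "(\<Sum>F \<in> flats M. (-1) ^ r F * (if F = ground M then p else inverse_KL (restriction M F))
         * reversal (rk (contraction M F)) (char_poly (contraction M F))) = (-1) ^ rk M * p + rest" for p
    unfolding rest_def
    by (subst sum.remove[OF finite_flats ground_flat])
      (simp add: reversal_char_poly_contraction_ground rk_eq_r)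
  have uniq: "p = q" if p: "2 * degree p < rk M" "(-1) ^ rk M * reversal (rk M) p = (-1) ^ rk M * p + rest" for p
  proof (rule reversal_diff_unique[OF p(1) deg])
    have "(-1) ^ rk M * (reversal (rk M) p - p) = (-1) ^ rk M * (reversal (rk M) q - q)"
      using p(2) eq unfolding split by (simp only: right_diff_distrib)
    \<comment> \<open>A second multiplication by the sign cancels the first.\<close>
    then have "(-1) ^ rk M * ((-1) ^ rk M * (reversal (rk M) p - p)) =
        (-1) ^ rk M * ((-1) ^ rk M * (reversal (rk M) q - q))"
      by (simp only:)
    then show "reversal (rk M) p - p = reversal (rk M) q - q"
      by (simp only: left_minus_one_mult_self)
  qed
  have "(THE q. 2 * degree q < rk M \<and>
      (-1) ^ rk M * reversal (rk M) q = (-1) ^ rk M * q + rest) = q"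
    by (rule the_equality, rule conjI[OF deg eq[unfolded split]], elim conjE, rule uniq)
  then show ?thesis
    using \<open>rk M \<noteq> 0\<close> finite_ground by (subst inverse_KL.simps) (simp only: split if_False not_not simp_thms)
qed

end

section \<open>Boolean matroids\<close>

text \<open>Expansion of the product of \<open>a + b\<close> over \<open>S\<close>: \<open>X\<close>
  records the factors from which \<open>a\<close> is chosen. The sums over flats below are brought
  to this form.\<close>

lemma sum_Pow_power:
  fixes a b :: "'a::comm_semiring_1"
  assumes "finite S"
  shows "(\<Sum>X\<in>Pow S. a ^ card X * b ^ card (S - X)) = (a + b) ^ card S"
  using prod_add[OF assms, of "\<lambda>_. a" "\<lambda>_. b"] by simp

lemma sum_Pow_power_1:
  fixes a :: "'a::comm_semiring_1"
  assumes "finite S"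
  shows "(\<Sum>X\<in>Pow S. a ^ card X) = (1 + a) ^ card S"
  using sum_Pow_power[OF assms, of a 1] by (simp add: add.commute)

lemma sum_interval_eq_Pow:
  assumes "X \<subseteq> Y"
  shows "(\<Sum>Z \<in> {Z. X \<subseteq> Z \<and> Z \<subseteq> Y}. f Z) = (\<Sum>W \<in> Pow (Y - X). f (X \<union> W))"
  using assms
  by (intro sum.reindex_bij_witness[of _ "\<lambda>W. X \<union> W" "\<lambda>Z. Z - X"])
    (auto simp: Un_absorb1)

lemma monom_power_eq: "monom (c ^ k) k = [:0, c:] ^ k"
  using monom_power[of c 1 k] by (simp add: monom_Suc monom_0)

text \<open>Restrictions of the thagomizer matroid to flats without the edge \<open>{A, B}\<close>
  have this form.\<close>

definition boolean_matroid :: "'a set \<Rightarrow> 'a matroid" where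
  "boolean_matroid E = \<lparr>ground = E, indep = Pow E\<rparr>"

lemma finite_matroid_boolean:
  assumes fin: "finite E"
  shows "finite_matroid (boolean_matroid E)"
proof
  fix I J assume "I \<in> indep (boolean_matroid E)" "J \<in> indep (boolean_matroid E)" "card I < card J"
  then have "I \<subseteq> E" "J \<subseteq> E" "\<not> J \<subseteq> I"
    using fin by (auto simp: boolean_matroid_def dest: card_mono[OF finite_subset[OF _ fin]])
  then show "\<exists>x\<in>J - I. insert x I \<in> indep (boolean_matroid E)"
    by (auto simp: boolean_matroid_def)
qed (use fin in \<open>auto simp: boolean_matroid_def\<close>)

lemma restriction_boolean: "X \<subseteq> E \<Longrightarrow> restriction (boolean_matroid E) X = boolean_matroid X"
  by (auto simp: restriction_def boolean_matroid_def)

lemma rk_boolean: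
  assumes "finite E"
  shows "rk (boolean_matroid E) = card E"
  unfolding rk_def boolean_matroid_def
  by (simp, intro Max_eqI) (use assms in \<open>auto intro: card_mono\<close>)

lemma flats_boolean:
  assumes fin: "finite E"
  shows "flats (boolean_matroid E) = Pow E"
proof -
  have "rk (restriction (boolean_matroid E) F) < rk (restriction (boolean_matroid E) (insert x F))"
    if "F \<subseteq> E" "x \<in> E - F" for x F
    using that finite_subset[OF _ fin] by (simp add: restriction_boolean rk_boolean)
  then show ?thesis by (auto simp: flats_def) (auto simp: boolean_matroid_def)
qed

text \<open>The Moebius function is \<open>(-1) ^ card (G - F)\<close>, since its interval sums are
  powers of \<open>1 - 1\<close>; weighted with \<open>t ^ card (G - F)\<close> it sums to a power
  of \<open>1 - t\<close>.\<close>

lemma reversal_char_poly_contraction_boolean: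
  assumes fin: "finite E" and F: "F \<subseteq> E"
  shows "reversal (rk (contraction (boolean_matroid E) F)) (char_poly (contraction (boolean_matroid E) F))
    = [:1, -1:] ^ card (E - F)"
proof -
  interpret finite_matroid "boolean_matroid E"
    using fin by (rule finite_matroid_boolean)
  have r: "r X = card X" if "X \<subseteq> E" for X
    using that finite_subset[OF _ fin] by (simp add: restriction_boolean rk_boolean)
  have "reversal (rk (contraction (boolean_matroid E) F)) (char_poly (contraction (boolean_matroid E) F))
    = (\<Sum>G \<in> {G \<in> flats (boolean_matroid E). F \<subseteq> G}. monom ((-1) ^ card (G - F)) (r G - r F))"
  proof (rule reversal_char_poly_contraction)
    fix G assume G: "G \<in> flats (boolean_matroid E)" "F \<subset> G"
    then have GE: "G \<subseteq> E" by (simp add: flats_boolean fin)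
    have "{H \<in> flats (boolean_matroid E). F \<subseteq> H \<and> H \<subseteq> G} = {H. F \<subseteq> H \<and> H \<subseteq> G}"
      using GE by (auto simp: flats_boolean fin)
    then have "(\<Sum>H \<in> {H \<in> flats (boolean_matroid E). F \<subseteq> H \<and> H \<subseteq> G}. (-1::int) ^ card (H - F)) =
        (\<Sum>W \<in> Pow (G - F). (-1::int) ^ card (F \<union> W - F))"
      using G by (simp only: sum_interval_eq_Pow psubset_imp_subset)
    also have "\<dots> = (\<Sum>W \<in> Pow (G - F). (-1::int) ^ card W)"
      by (intro sum.cong refl arg_cong[where f = "\<lambda>X. _ ^ card X"]) auto
    also have "\<dots> = 0"
    proof -
      have "finite (G - F)" using GE fin finite_subset by auto
      moreover have "G - F \<noteq> {}" using G by auto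
      ultimately show ?thesis by (simp add: sum_Pow_power_1 card_gt_0_iff)
    qed
    finally show "(\<Sum>H \<in> {H \<in> flats (boolean_matroid E). F \<subseteq> H \<and> H \<subseteq> G}. (-1::int) ^ card (H - F)) = 0" .
  qed (use F fin in \<open>auto simp: flats_boolean\<close>)
  also have "{G \<in> flats (boolean_matroid E). F \<subseteq> G} = {G. F \<subseteq> G \<and> G \<subseteq> E}"
    using fin by (auto simp: flats_boolean)
  also have "(\<Sum>G \<in> {G. F \<subseteq> G \<and> G \<subseteq> E}. monom ((-1::int) ^ card (G - F)) (r G - r F)) =
      (\<Sum>W \<in> Pow (E - F). [:0, -1:] ^ card W)"
    unfolding sum_interval_eq_Pow[OF F]
  proof (intro sum.cong refl)
    fix W assume W: "W \<in> Pow (E - F)"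
    then have "F \<union> W - F = W" "F \<inter> W = {}" "finite W" "finite F" "F \<union> W \<subseteq> E"
      using F finite_subset[OF _ fin] by auto
    then show "monom ((-1) ^ card (F \<union> W - F)) (r (F \<union> W) - r F) = [:0, -1::int:] ^ card W"
      using F by (simp add: r card_Un_disjoint monom_power_eq)
  qed
  also have "\<dots> = [:1, -1:] ^ card (E - F)"
    using fin by (subst sum_Pow_power_1) (auto simp: one_pCons)
  finally show ?thesis .
qed

text \<open>With 1 inserted for every restriction the right side is a power of
  \<open>-1 + (1 - t) = -t\<close>, and reversing 1 at order \<open>card E\<close> gives the same
  power of \<open>t\<close>.\<close>

lemma inverse_KL_boolean:
  assumes "finite E"
  shows "inverse_KL (boolean_matroid E) = 1"
  using assms
proof (induction E rule: finite_psubset_induct)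
  case (psubset E)
  interpret finite_matroid "boolean_matroid E"
    using psubset by (intro finite_matroid_boolean)
  note rkE = rk_boolean[OF psubset.hyps]
  have gr: "ground (boolean_matroid E) = E" by (simp add: boolean_matroid_def)
  show ?case
  proof (cases "E = {}")
    case True
    then show ?thesis
      using rkE by (subst inverse_KL.simps) (simp add: boolean_matroid_def)
  next
    case False
    show ?thesis
    proof (rule inverse_KL_eqI)
      show "rk (boolean_matroid E) \<noteq> 0" "2 * degree (1 :: int poly) < rk (boolean_matroid E)"
        using False psubset.hyps by (simp_all add: rkE card_gt_0_iff)
      have "(\<Sum>F\<in>flats (boolean_matroid E). (-1) ^ r F *
          (if F = ground (boolean_matroid E) then 1 else inverse_KL (restriction (boolean_matroid E) F)) *
          reversal (rk (contraction (boolean_matroid E) F)) (char_poly (contraction (boolean_matroid E) F)))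
        = (\<Sum>F\<in>Pow E. (-1) ^ card F * [:1, -1:] ^ card (E - F))"
        unfolding flats_boolean[OF psubset.hyps] gr
      proof (intro sum.cong refl)
        fix F assume F: "F \<in> Pow E"
        then have "finite F" using psubset.hyps finite_subset by auto
        then show "(-1) ^ r F * (if F = E then 1 else inverse_KL (restriction (boolean_matroid E) F)) *
          reversal (rk (contraction (boolean_matroid E) F)) (char_poly (contraction (boolean_matroid E) F))
          = (-1) ^ card F * [:1, -1:] ^ card (E - F)"
          using F psubset.hyps
          by (auto simp: restriction_boolean rk_boolean reversal_char_poly_contraction_boolean
              psubset.IH psubset_eq)
      qed
      also have "\<dots> = (-1 + [:1, -1:]) ^ card E"
        using psubset.hyps by (rule sum_Pow_power)
      also have "-1 + [:1, -1:] = [:0, -1::int:]" by (simp add: one_pCons)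
      also have "[:0, -1::int:] ^ card E = (-1) ^ card E * reversal (card E) 1"
      proof -
        have "reversal (card E) (1 :: int poly) = [:0, 1:] ^ card E"
          using monom_power_eq[of "1::int" "card E"] by (simp add: reversal_def)
        then show ?thesis by (simp add: one_pCons flip: power_mult_distrib)
      qed
      finally show "(-1) ^ rk (boolean_matroid E) * reversal (rk (boolean_matroid E)) 1 =
        (\<Sum>F\<in>flats (boolean_matroid E). (-1) ^ r F *
          (if F = ground (boolean_matroid E) then 1 else inverse_KL (restriction (boolean_matroid E) F)) *
          reversal (rk (contraction (boolean_matroid E) F)) (char_poly (contraction (boolean_matroid E) F)))"
        unfolding rkE by (rule sym)
    qed
  qed
qed

section \<open>The thagomizer matroid on a set of spikes\<close>

text \<open>Arbitrary spike sets replace \<open>{1..n}\<close>: the restriction to a flat containing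
  \<open>{A, B}\<close> is then literally a matroid of the same kind, and the induction needs no
  isomorphisms.\<close>

definition spiked_graph :: "nat set \<Rightarrow> thag_vertex set set" where
  "spiked_graph S = {{A, B}} \<union> (\<lambda>j. {A, Spike j}) ` S \<union> (\<lambda>j. {B, Spike j}) ` S"

text \<open>\<open>P\<close> and \<open>Q\<close> may overlap, so every subset of a spiked graph is
  a double star with or without \<open>{A, B}\<close>; only flats require disjointness.\<close>

definition double_star :: "nat set \<Rightarrow> nat set \<Rightarrow> thag_vertex set set" where
  "double_star P Q = (\<lambda>j. {A, Spike j}) ` P \<union> (\<lambda>j. {B, Spike j}) ` Q"

text \<open>\<open>A_spikes\<close>, \<open>B_spikes\<close> and membership of \<open>{A, B}\<close>
  serve as coordinates of an edge set.\<close>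

definition A_spikes :: "thag_vertex set set \<Rightarrow> nat set" where
  "A_spikes X = {j. {A, Spike j} \<in> X}"

definition B_spikes :: "thag_vertex set set \<Rightarrow> nat set" where
  "B_spikes X = {j. {B, Spike j} \<in> X}"

abbreviation spiked_matroid :: "nat set \<Rightarrow> thag_vertex set matroid" where
  "spiked_matroid S \<equiv> graphic_matroid (spiked_graph S)"

section \<open>Edge sets in coordinates\<close>

lemma spikes_spiked_graph [simp]:
  "A_spikes (spiked_graph S) = S" "B_spikes (spiked_graph S) = S" "{A, B} \<in> spiked_graph S"
  by (simp_all add: A_spikes_def B_spikes_def spiked_graph_def doubleton_eq_iff image_iff)

lemma spike_edge_in_spiked_graph [simp]:
  "{A, Spike j} \<in> spiked_graph S \<longleftrightarrow> j \<in> S" "{B, Spike j} \<in> spiked_graph S \<longleftrightarrow> j \<in> S"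
  by (auto simp: spiked_graph_def doubleton_eq_iff image_iff)

lemma spikes_double_star [simp]:
  "A_spikes (double_star P Q) = P" "B_spikes (double_star P Q) = Q" "{A, B} \<notin> double_star P Q"
  by (simp_all add: A_spikes_def B_spikes_def double_star_def doubleton_eq_iff image_iff)

lemma spikes_mono: "X \<subseteq> Y \<Longrightarrow> A_spikes X \<subseteq> A_spikes Y \<and> B_spikes X \<subseteq> B_spikes Y"
  by (auto simp: A_spikes_def B_spikes_def)

lemma spikes_insert [simp]:
  "A_spikes (insert {A, B} X) = A_spikes X" "B_spikes (insert {A, B} X) = B_spikes X"
  "A_spikes (insert {A, Spike j} X) = insert j (A_spikes X)" "B_spikes (insert {A, Spike j} X) = B_spikes X"
  "A_spikes (insert {B, Spike j} X) = A_spikes X" "B_spikes (insert {B, Spike j} X) = insert j (B_spikes X)"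
  by (simp_all add: A_spikes_def B_spikes_def doubleton_eq_iff set_eq_iff[where 'a = nat])

lemma edges_distinct [simp]:
  "{A, Spike j} \<noteq> {A, B}" "{B, Spike j} \<noteq> {A, B}" "{A, Spike j} \<noteq> {B, Spike k}"
  "{A, B} \<noteq> {A, Spike j}" "{A, B} \<noteq> {B, Spike j}" "{B, Spike k} \<noteq> {A, Spike j}"
  by (simp_all add: doubleton_eq_iff)

lemma edge_cases:
  assumes "x \<in> spiked_graph S"
  obtains "x = {A, B}" | j where "j \<in> S" "x = {A, Spike j}" | j where "j \<in> S" "x = {B, Spike j}"
  using assms unfolding spiked_graph_def by blast

lemma edges_decompose:
  assumes "X \<subseteq> spiked_graph S"
  shows "X = (if {A, B} \<in> X then {{A, B}} else {}) \<union> double_star (A_spikes X) (B_spikes X)"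
proof (intro set_eqI iffI)
  fix x assume "x \<in> X"
  with assms have "x \<in> spiked_graph S" by auto
  then show "x \<in> (if {A, B} \<in> X then {{A, B}} else {}) \<union> double_star (A_spikes X) (B_spikes X)"
    by (cases rule: edge_cases) (use \<open>x \<in> X\<close> in \<open>simp_all add: A_spikes_def B_spikes_def double_star_def\<close>)
next
  fix x assume "x \<in> (if {A, B} \<in> X then {{A, B}} else {}) \<union> double_star (A_spikes X) (B_spikes X)"
  then show "x \<in> X"
    unfolding A_spikes_def B_spikes_def double_star_def by (cases "{A, B} \<in> X") (simp_all, blast+)
qed

lemma subset_spiked_graph:
  "double_star P Q \<subseteq> spiked_graph T \<longleftrightarrow> P \<subseteq> T \<and> Q \<subseteq> T"
  "spiked_graph U \<subseteq> spiked_graph T \<longleftrightarrow> U \<subseteq> T"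
  "double_star P Q \<subseteq> double_star P' Q' \<longleftrightarrow> P \<subseteq> P' \<and> Q \<subseteq> Q'"
  "\<not> spiked_graph U \<subseteq> double_star P' Q'"
proof -
  show "double_star P Q \<subseteq> spiked_graph T \<longleftrightarrow> P \<subseteq> T \<and> Q \<subseteq> T"
  proof
    assume "double_star P Q \<subseteq> spiked_graph T"
    from spikes_mono[OF this] show "P \<subseteq> T \<and> Q \<subseteq> T" by simp
  next
    assume "P \<subseteq> T \<and> Q \<subseteq> T"
    then show "double_star P Q \<subseteq> spiked_graph T" unfolding spiked_graph_def double_star_def by blast
  qed
  show "spiked_graph U \<subseteq> spiked_graph T \<longleftrightarrow> U \<subseteq> T"
  proof
    assume "spiked_graph U \<subseteq> spiked_graph T"
    from spikes_mono[OF this] show "U \<subseteq> T" by simp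
  next
    assume "U \<subseteq> T"
    then show "spiked_graph U \<subseteq> spiked_graph T" unfolding spiked_graph_def by (intro Un_mono image_mono) auto
  qed
  show "double_star P Q \<subseteq> double_star P' Q' \<longleftrightarrow> P \<subseteq> P' \<and> Q \<subseteq> Q'"
  proof
    assume "double_star P Q \<subseteq> double_star P' Q'"
    from spikes_mono[OF this] show "P \<subseteq> P' \<and> Q \<subseteq> Q'" by simp
  next
    assume "P \<subseteq> P' \<and> Q \<subseteq> Q'"
    then show "double_star P Q \<subseteq> double_star P' Q'" unfolding double_star_def by (intro Un_mono image_mono) auto
  qed
  show "\<not> spiked_graph U \<subseteq> double_star P' Q'"
    using spikes_spiked_graph(3)[of U] spikes_double_star(3)[of P' Q'] by blast
qed

lemma double_star_eq_iff: "double_star P Q = double_star P' Q' \<longleftrightarrow> P = P' \<and> Q = Q'"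
  by (metis spikes_double_star(1,2))

lemma spiked_graph_eq_iff: "spiked_graph U = spiked_graph T \<longleftrightarrow> U = T"
  by (metis spikes_spiked_graph(1))

lemma spiked_neq_double_star: "spiked_graph U \<noteq> double_star P Q"
  by (metis spikes_spiked_graph(3) spikes_double_star(3))

lemma card_double_star:
  assumes "finite P" "finite Q"
  shows "card (double_star P Q) = card P + card Q"
proof -
  have "inj_on (\<lambda>j. {A, Spike j}) P" "inj_on (\<lambda>j. {B, Spike j}) Q"
    by (auto simp: inj_on_def doubleton_eq_iff)
  moreover have "(\<lambda>j. {A, Spike j}) ` P \<inter> (\<lambda>j. {B, Spike j}) ` Q = {}"
    by (force simp: disjoint_iff)
  ultimately show ?thesis
    using assms by (simp add: double_star_def card_Un_disjoint card_image)
qed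

lemma finite_spikes:
  assumes "finite S" "X \<subseteq> spiked_graph S"
  shows "finite X" "finite (A_spikes X)" "finite (B_spikes X)" "A_spikes X \<subseteq> S" "B_spikes X \<subseteq> S"
proof -
  show "A_spikes X \<subseteq> S" "B_spikes X \<subseteq> S" using spikes_mono[OF assms(2)] by auto
  then show "finite (A_spikes X)" "finite (B_spikes X)" using finite_subset[OF _ assms(1)] by auto
  have "finite (spiked_graph S)" using assms by (simp add: spiked_graph_def)
  then show "finite X" using assms(2) by (rule finite_subset[rotated])
qed

text \<open>Union and intersection are kept apart because rank counts the spikes touched, while
  independence limits the spikes joined to both ends.\<close>

lemma card_edges:
  assumes "finite S" "X \<subseteq> spiked_graph S"
  shows "card X = (if {A, B} \<in> X then 1 else 0) + card (A_spikes X \<union> B_spikes X)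
    + card (A_spikes X \<inter> B_spikes X)"
proof -
  have "card X = (if {A, B} \<in> X then 1 else 0) + (card (A_spikes X) + card (B_spikes X))"
    using finite_spikes[OF assms]
    by (subst edges_decompose[OF assms(2)], subst card_Un_disjoint)
      (auto simp: card_double_star, auto simp: double_star_def)
  then show ?thesis using card_Un_Int finite_spikes[OF assms] by (metis add.assoc)
qed

section \<open>Cycles, independent sets and the matroid axioms\<close>

lemma cycle_edge: "i < length vs \<Longrightarrow> {vs ! i, vs ! (Suc i mod length vs)} \<in> cycle_edges vs"
  by (auto simp: cycle_edges_def)

lemma cycle_edges_eq_image:
  "cycle_edges vs = (\<lambda>i. {vs ! i, vs ! (Suc i mod length vs)}) ` {..<length vs}"
  unfolding cycle_edges_def by blast

lemma cycle_edges_3: "cycle_edges [x, y, z] = {{x, y}, {y, z}, {z, x}}"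
  unfolding cycle_edges_eq_image by (simp add: lessThan_Suc) (simp add: insert_commute)

lemma cycle_edges_4: "cycle_edges [x, y, z, w] = {{x, y}, {y, z}, {z, w}, {w, x}}"
  unfolding cycle_edges_eq_image by (simp add: lessThan_Suc) (simp add: insert_commute)

lemma spike_neighbour:
  assumes "{Spike j, v} \<in> spiked_graph S"
  shows "v = A \<or> v = B"
  using assms by (simp add: spiked_graph_def doubleton_eq_iff image_iff) blast

text \<open>A spike can only be adjacent to \<open>A\<close> and \<open>B\<close>, and its two
  neighbours on a cycle are distinct.\<close>

lemma spike_in_cycle:
  assumes X: "X \<subseteq> spiked_graph S" and vs: "3 \<le> length vs" "distinct vs" "cycle_edges vs \<subseteq> X"
    and spike: "Spike j \<in> set vs"
  shows "j \<in> A_spikes X \<inter> B_spikes X"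
proof -
  let ?n = "length vs"
  obtain i where i: "i < ?n" "vs ! i = Spike j" using spike by (auto simp: in_set_conv_nth)
  \<comment> \<open>\<open>s\<close> and \<open>p\<close> are the cyclic successor and predecessor
    of \<open>i\<close>; they differ because a cycle has at least three vertices.\<close>
  define s where "s = Suc i mod ?n"
  define p where "p = (if i = 0 then ?n - 1 else i - 1)"
  have p: "p < ?n" "Suc p mod ?n = i" using i vs(1) by (auto simp: p_def)
  have s: "s < ?n" "s \<noteq> p" using i vs(1)
    by (auto simp: s_def p_def mod_Suc split: if_splits)
  have "vs ! s \<noteq> vs ! p" using s p vs(2) by (simp add: nth_eq_iff_index_eq)
  moreover have e: "{Spike j, vs ! s} \<in> X" "{vs ! p, Spike j} \<in> X"
    using cycle_edge[OF i(1)] cycle_edge[OF p(1)] vs(3) i p by (auto simp: s_def)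
  moreover have "vs ! s \<in> {A, B}" "vs ! p \<in> {A, B}"
    using spike_neighbour[OF subsetD[OF X e(1)]] spike_neighbour[of j "vs ! p" S] subsetD[OF X e(2)]
    by (simp_all add: insert_commute)
  ultimately have "vs ! s = A \<and> vs ! p = B \<or> vs ! s = B \<and> vs ! p = A" by auto
  with e show ?thesis unfolding A_spikes_def B_spikes_def by (metis IntI insert_commute mem_Collect_eq)
qed

text \<open>A spike joined to both ends closes a triangle with \<open>{A, B}\<close>, and two such
  spikes close a 4-cycle through \<open>A\<close> and \<open>B\<close>. Conversely a cycle meets
  only \<open>A\<close>, \<open>B\<close> and doubly joined spikes; with at most one such spike it
  is a triangle through \<open>{A, B}\<close>, which the bound excludes.\<close>

lemma forest_iff:
  assumes S: "finite S" and X: "X \<subseteq> spiked_graph S"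
  shows "forest X \<longleftrightarrow>
    (if {A, B} \<in> X then 1 else 0) + card (A_spikes X \<inter> B_spikes X) \<le> (1::nat)"
proof
  let ?D = "A_spikes X \<inter> B_spikes X"
  have finD: "finite ?D" using finite_spikes[OF assms] by auto
  assume forest: "forest X"
  have no_cycle: "\<not> cycle_edges vs \<subseteq> X" if "3 \<le> length vs" "distinct vs" for vs
    using forest that unfolding forest_def by blast
  have "\<not> ({A, B} \<in> X \<and> j \<in> ?D)" for j
    using no_cycle[of "[A, B, Spike j]"]
    by (simp add: cycle_edges_3 A_spikes_def B_spikes_def insert_commute)
  moreover have "j = k" if "j \<in> ?D" "k \<in> ?D" for j k
    using no_cycle[of "[A, Spike j, B, Spike k]"] that
    by (auto simp: cycle_edges_4 A_spikes_def B_spikes_def insert_commute)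
  then have "card ?D \<le> 1" using finD by (auto simp: card_le_Suc0_iff_eq)
  ultimately show "(if {A, B} \<in> X then 1 else 0) + card ?D \<le> 1"
    by (auto simp: card_eq_0_iff)
next
  let ?D = "A_spikes X \<inter> B_spikes X"
  have finD: "finite ?D" using finite_spikes[OF assms] by auto
  assume le: "(if {A, B} \<in> X then 1 else 0) + card ?D \<le> (1::nat)"
  show "forest X"
    unfolding forest_def
  proof
    assume "\<exists>vs. 3 \<le> length vs \<and> distinct vs \<and> cycle_edges vs \<subseteq> X"
    then obtain vs where vs: "3 \<le> length vs" "distinct vs" "cycle_edges vs \<subseteq> X" by blast
    have sub: "set vs \<subseteq> {A, B} \<union> Spike ` ?D"
    proof
      fix v assume "v \<in> set vs"
      then show "v \<in> {A, B} \<union> Spike ` ?D" using spike_in_cycle[OF X vs]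
        by (cases v rule: thag_vertex.exhaust) auto
    qed
    have "card (set vs) = length vs" using vs(2) by (rule distinct_card)
    then have "3 \<le> card (set vs)" using vs by simp
    have "card (set vs) \<le> card ({A, B} \<union> Spike ` ?D)" using sub finD by (intro card_mono) auto
    also have "\<dots> = 2 + card ?D" using finD by (subst card_Un_disjoint) (auto simp: card_image inj_on_def)
    \<comment> \<open>At least three vertices force a doubly joined spike, which exhausts the bound:
      no second one, and no edge \<open>{A, B}\<close>.\<close>
    finally have "card ?D = 1" "{A, B} \<notin> X" "length vs = 3"
      using le vs \<open>card (set vs) = length vs\<close> by (auto split: if_splits)
    then obtain j where D: "?D = {j}" by (auto simp: card_1_singleton_iff)
    obtain x y z where xyz: "vs = [x, y, z]"
      using \<open>length vs = 3\<close> by (auto simp: numeral_3_eq_3 length_Suc_conv)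
    have "{{x, y}, {y, z}, {z, x}} \<subseteq> X"
      using vs(3) by (simp only: xyz cycle_edges_3)
    then show False
      using \<open>{A, B} \<notin> X\<close> sub vs(2) unfolding D xyz by (auto simp: insert_commute)
  qed
qed

lemma indep_spiked_iff:
  assumes "finite S"
  shows "X \<in> indep (spiked_matroid S) \<longleftrightarrow> X \<subseteq> spiked_graph S \<and>
    (if {A, B} \<in> X then 1 else 0) + card (A_spikes X \<inter> B_spikes X) \<le> (1::nat)"
  using forest_iff[OF assms] by (auto simp: graphic_matroid_def)

text \<open>For augmentation, call the number bounded by 1 in \<open>indep_spiked_iff\<close> the
  excess. If \<open>I\<close> has excess 0, any edge of \<open>J - I\<close> may be added. Otherwise
  the larger \<open>J\<close> touches a spike that \<open>I\<close> does not touch, and an edge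
  there leaves the excess unchanged.\<close>

lemma finite_matroid_spiked:
  assumes S: "finite S"
  shows "finite_matroid (spiked_matroid S)"
proof
  show "finite (ground (spiked_matroid S))"
    using finite_spikes(1)[OF S order_refl] by (simp add: graphic_matroid_def)
next
  fix I J assume "I \<in> indep (spiked_matroid S)" "J \<subseteq> I"
  then show "J \<in> indep (spiked_matroid S)"
    unfolding graphic_matroid_def forest_def by (simp, meson order_trans)
next
  fix I J assume I: "I \<in> indep (spiked_matroid S)" and J: "J \<in> indep (spiked_matroid S)"
    and less: "card I < card J"
  let ?e = "\<lambda>X. if {A, B} \<in> X then 1 else (0::nat)"
  let ?D = "\<lambda>X. A_spikes X \<inter> B_spikes X" and ?U = "\<lambda>X. A_spikes X \<union> B_spikes X"
  have sub: "I \<subseteq> spiked_graph S" "J \<subseteq> spiked_graph S"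
    and le: "?e I + card (?D I) \<le> 1" "?e J + card (?D J) \<le> 1"
    using I J by (simp_all only: indep_spiked_iff[OF S])
  note fin = finite_spikes[OF S sub(1)] finite_spikes[OF S sub(2)]
  have cards: "card I = ?e I + card (?U I) + card (?D I)" "card J = ?e J + card (?U J) + card (?D J)"
    using sub by (auto simp only: card_edges[OF S])
  have "\<not> J \<subseteq> I" using less card_mono[OF fin(1)] by (auto simp: not_le[symmetric])
  show "\<exists>x\<in>J - I. insert x I \<in> indep (spiked_matroid S)"
  proof (cases "?e I + card (?D I) = 0")
    case True
    then have e: "{A, B} \<notin> I" and D: "?D I = {}" using fin by (auto split: if_splits)
    from \<open>\<not> J \<subseteq> I\<close> obtain x where x: "x \<in> J" "x \<notin> I" by auto
    then have "x \<in> spiked_graph S" using sub by auto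
    moreover have "?e (insert x I) + card (?D (insert x I)) \<le> 1"
      using \<open>x \<in> spiked_graph S\<close>
    proof (cases rule: edge_cases)
      case 1
      then show ?thesis using D by simp
    next
      case (2 j)
      have "?D (insert x I) \<subseteq> {j}" using D 2 by auto
      then show ?thesis using e 2 card_mono[of "{j}" "?D (insert x I)"] by simp
    next
      case (3 j)
      have "?D (insert x I) \<subseteq> {j}" using D 3 by auto
      then show ?thesis using e 3 card_mono[of "{j}" "?D (insert x I)"] by simp
    qed
    ultimately show ?thesis using sub x by (intro bexI[of _ x]) (auto simp only: indep_spiked_iff[OF S])
  next
    case False
    have "\<not> ?U J \<subseteq> ?U I"
    proof
      assume "?U J \<subseteq> ?U I"
      then have "card (?U J) \<le> card (?U I)" using fin by (intro card_mono) auto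
      then show False using False le less cards by linarith
    qed
    then obtain j where j: "j \<in> ?U J" "j \<notin> ?U I" by auto
    then obtain x where x: "x = {A, Spike j} \<or> x = {B, Spike j}" "x \<in> J"
      by (auto simp: A_spikes_def B_spikes_def)
    have "x \<notin> I" using j x by (auto simp: A_spikes_def B_spikes_def)
    have "?e (insert x I) = ?e I" using x by (elim disjE) simp_all
    moreover have "?D (insert x I) = ?D I" using x j by auto
    ultimately have "insert x I \<in> indep (spiked_matroid S)"
      using le(1) sub x unfolding indep_spiked_iff[OF S] by auto
    then show ?thesis using x \<open>x \<notin> I\<close> by blast
  qed
next
  show "{} \<in> indep (spiked_matroid S)"
    by (simp add: indep_spiked_iff[OF S] A_spikes_def)
qed (simp add: graphic_matroid_def)

text \<open>A maximal forest in \<open>X\<close> has one edge for each touched spike, and one more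
  if \<open>X\<close> connects \<open>A\<close> with \<open>B\<close>, directly or through a
  spike.\<close>

lemma rk_restriction_spiked:
  assumes S: "finite S" and X: "X \<subseteq> spiked_graph S"
  shows "rk (restriction (spiked_matroid S) X) = card (A_spikes X \<union> B_spikes X) +
    (if {A, B} \<in> X \<or> A_spikes X \<inter> B_spikes X \<noteq> {} then 1 else 0)" (is "_ = ?R")
proof -
  interpret finite_matroid "spiked_matroid S" using S by (rule finite_matroid_spiked)
  note fin = finite_spikes[OF S X]
  show ?thesis
  proof (rule antisym)
    obtain I where I: "I \<in> indep (spiked_matroid S)" "I \<subseteq> X" and card_I: "card I = r X"
      by (rule r_attained)
    have le: "(if {A, B} \<in> I then 1 else 0) + card (A_spikes I \<inter> B_spikes I) \<le> (1::nat)"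
      and IS: "I \<subseteq> spiked_graph S"
      using I by (simp_all only: indep_spiked_iff[OF S])
    have "card (A_spikes I \<union> B_spikes I) \<le> card (A_spikes X \<union> B_spikes X)"
      using fin spikes_mono[OF I(2)] by (intro card_mono) auto
    moreover have "(if {A, B} \<in> I then 1 else 0) + card (A_spikes I \<inter> B_spikes I) = 0"
      if "\<not> ({A, B} \<in> X \<or> A_spikes X \<inter> B_spikes X \<noteq> {})"
    proof -
      have "A_spikes I \<inter> B_spikes I = {}" "{A, B} \<notin> I"
        using spikes_mono[OF I(2)] that I(2) by auto
      then show ?thesis by simp
    qed
    ultimately show "r X \<le> ?R"
      using le unfolding card_I[symmetric] card_edges[OF S IS] by (auto simp del: add_is_0)
  next
    \<comment> \<open>One edge at each touched spike, the one to \<open>A\<close> being preferred;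
      at a doubly joined spike the edge to \<open>B\<close> is then still available.\<close>
    let ?P = "A_spikes X" and ?Q = "B_spikes X - A_spikes X"
    have PQ: "double_star ?P ?Q \<subseteq> X"
      by (subst (4) edges_decompose[OF X]) (auto simp: double_star_def)
    have card_PQ: "card ?P + card ?Q = card (A_spikes X \<union> B_spikes X)"
      using fin by (subst card_Un_disjoint[symmetric]) auto
    consider "{A, B} \<in> X" | j where "{A, B} \<notin> X" "j \<in> A_spikes X \<inter> B_spikes X"
      | "{A, B} \<notin> X" "A_spikes X \<inter> B_spikes X = {}"
      by blast
    then show "?R \<le> r X"
    proof cases
      case 1
      have "card (insert {A, B} (double_star ?P ?Q)) \<le> r X"
        using 1 X PQ by (intro card_le_r) (simp_all add: indep_spiked_iff[OF S])
      then show ?thesis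
        using 1 fin card_PQ finite_subset[OF PQ] by (simp add: card_double_star)
    next
      case 2
      have "{B, Spike j} \<in> X" "{B, Spike j} \<notin> double_star ?P ?Q"
        using 2 spikes_double_star(2)[of ?P ?Q] by (auto simp: B_spikes_def)
      moreover have "insert j ?Q \<inter> ?P = {j}" using 2 by auto
      moreover have "{B, Spike j} \<in> spiked_graph S" "double_star ?P ?Q \<subseteq> spiked_graph S"
        using \<open>{B, Spike j} \<in> X\<close> X PQ by blast+
      ultimately have "card (insert {B, Spike j} (double_star ?P ?Q)) \<le> r X"
        using PQ by (intro card_le_r) (simp_all add: indep_spiked_iff[OF S] Int_commute)
      then show ?thesis
        using 2 fin card_PQ finite_subset[OF PQ] \<open>{B, Spike j} \<notin> double_star ?P ?Q\<close>
        by (auto simp: card_double_star)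
    next
      case 3
      then have "card X \<le> r X" using X by (intro card_le_r) (simp_all add: indep_spiked_iff[OF S])
      then show ?thesis using 3 by (simp add: card_edges[OF S X])
    qed
  qed
qed

section \<open>Restrictions and the list of flats\<close>

lemma ground_spiked [simp]: "ground (spiked_matroid S) = spiked_graph S"
  by (simp add: graphic_matroid_def)

lemma rk_restriction_spiked_graph:
  assumes "finite S" "T \<subseteq> S"
  shows "rk (restriction (spiked_matroid S) (spiked_graph T)) = card T + 1"
  using assms by (subst rk_restriction_spiked) (simp_all add: subset_spiked_graph)

lemma rk_restriction_double_star:
  assumes "finite S" "P \<subseteq> S" "Q \<subseteq> S" "P \<inter> Q = {}"
  shows "rk (restriction (spiked_matroid S) (double_star P Q)) = card P + card Q"
  using assms finite_subset[OF _ assms(1)]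
  by (subst rk_restriction_spiked) (simp_all add: subset_spiked_graph card_Un_disjoint)

lemma rk_spiked:
  assumes "finite S"
  shows "rk (spiked_matroid S) = card S + 1"
  using finite_matroid.rk_eq_r[OF finite_matroid_spiked[OF assms]]
    rk_restriction_spiked_graph[OF assms order_refl] by simp

lemma restriction_spiked_graph:
  "T \<subseteq> S \<Longrightarrow> restriction (spiked_matroid S) (spiked_graph T) = spiked_matroid T"
  using subset_spiked_graph(2)[of T S] by (auto simp: restriction_def graphic_matroid_def)

lemma restriction_double_star:
  assumes S: "finite S" and "P \<subseteq> S" "Q \<subseteq> S" "P \<inter> Q = {}"
  shows "restriction (spiked_matroid S) (double_star P Q) = boolean_matroid (double_star P Q)"
proof -
  have sub: "double_star P Q \<subseteq> spiked_graph S" using assms by (simp add: subset_spiked_graph)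
  have "X \<in> indep (spiked_matroid S)" if "X \<subseteq> double_star P Q" for X
  proof -
    have "{A, B} \<notin> X" using that spikes_double_star(3) by blast
    moreover have "A_spikes X \<inter> B_spikes X = {}" using spikes_mono[OF that] assms by auto
    moreover have "X \<subseteq> spiked_graph S" using that sub by (rule order_trans)
    ultimately show ?thesis by (simp add: indep_spiked_iff[OF S])
  qed
  then show ?thesis by (auto simp: restriction_def boolean_matroid_def)
qed

text \<open>If \<open>{A, B}\<close> lies in \<open>F\<close>, only an edge at an untouched spike
  raises the rank, so touched spikes must carry both edges. If not, adding \<open>{A, B}\<close>
  raises the rank only when no spike connects \<open>A\<close> with \<open>B\<close>; then every
  other new edge raises it too.\<close>

lemma flats_spiked:
  assumes S: "finite S"
  shows "flats (spiked_matroid S) = spiked_graph ` Pow S \<union>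
    {double_star P Q | P Q. P \<subseteq> S \<and> Q \<subseteq> S \<and> P \<inter> Q = {}}" (is "_ = ?L")
proof (rule set_eqI)
  fix F
  let ?r = "\<lambda>X. rk (restriction (spiked_matroid S) X)"
  let ?a = "A_spikes F" and ?b = "B_spikes F"
  show "F \<in> flats (spiked_matroid S) \<longleftrightarrow> F \<in> ?L"
  proof (cases "F \<subseteq> spiked_graph S")
    case False
    then have "F \<notin> flats (spiked_matroid S)" by (simp add: flats_def)
    moreover have "F \<noteq> spiked_graph T" if "T \<subseteq> S" for T
      using that False subset_spiked_graph(2) by metis
    moreover have "F \<noteq> double_star P Q" if "P \<subseteq> S" "Q \<subseteq> S" for P Q
      using that False subset_spiked_graph(1) by metis
    ultimately show ?thesis by auto
  next
    case F: True
    note fin = finite_spikes[OF S F]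
    have r_insert: "?r (insert x F) = card (A_spikes (insert x F) \<union> B_spikes (insert x F)) +
        (if {A, B} \<in> insert x F \<or> A_spikes (insert x F) \<inter> B_spikes (insert x F) \<noteq> {} then 1 else 0)"
      if "x \<in> spiked_graph S" for x
      using that F by (intro rk_restriction_spiked[OF S]) simp
    have flat_iff: "F \<in> flats (spiked_matroid S) \<longleftrightarrow>
        (\<forall>x\<in>spiked_graph S. x \<notin> F \<longrightarrow> ?r F < ?r (insert x F))"
      using F by (auto simp: flats_def)
    also have "\<dots> \<longleftrightarrow> ({A, B} \<notin> F \<longrightarrow> ?r F < ?r (insert {A, B} F)) \<and>
        (\<forall>j\<in>S. j \<notin> ?a \<longrightarrow> ?r F < ?r (insert {A, Spike j} F)) \<and>
        (\<forall>j\<in>S. j \<notin> ?b \<longrightarrow> ?r F < ?r (insert {B, Spike j} F))"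
      unfolding spiked_graph_def A_spikes_def B_spikes_def by blast
    also have "\<dots> \<longleftrightarrow> (if {A, B} \<in> F then ?a = ?b else ?a \<inter> ?b = {})"
    proof (cases "{A, B} \<in> F")
      case True
      have "?r F < ?r (insert {A, Spike j} F) \<longleftrightarrow> j \<notin> ?a \<union> ?b" if "j \<in> S" for j
        using that True fin
        by (subst r_insert) (simp_all add: rk_restriction_spiked[OF S F] card_insert_if)
      moreover have "?r F < ?r (insert {B, Spike j} F) \<longleftrightarrow> j \<notin> ?a \<union> ?b" if "j \<in> S" for j
        using that True fin
        by (subst r_insert) (simp_all add: rk_restriction_spiked[OF S F] card_insert_if)
      ultimately show ?thesis using True fin(4,5) by auto
    next
      case False
      have "?r F < ?r (insert {A, B} F) \<longleftrightarrow> ?a \<inter> ?b = {}"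
        using False by (subst r_insert) (simp_all add: rk_restriction_spiked[OF S F])
      moreover have "?r F < ?r (insert {A, Spike j} F)" if "j \<in> S" "j \<notin> ?a" "?a \<inter> ?b = {}" for j
        using that False fin
        by (subst r_insert) (auto simp: rk_restriction_spiked[OF S F] card_insert_if)
      moreover have "?r F < ?r (insert {B, Spike j} F)" if "j \<in> S" "j \<notin> ?b" "?a \<inter> ?b = {}" for j
        using that False fin
        by (subst r_insert) (auto simp: rk_restriction_spiked[OF S F] card_insert_if)
      ultimately show ?thesis using False by auto
    qed
    also have "\<dots> \<longleftrightarrow> F \<in> ?L"
    proof (cases "{A, B} \<in> F")
      case True
      have "F = spiked_graph ?a" if "?a = ?b"
        using True that by (subst edges_decompose[OF F]) (simp add: spiked_graph_def double_star_def)
      moreover have "?a = ?b" if "F = spiked_graph T" for T using that by simp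
      moreover have "F \<noteq> double_star P Q" for P Q using True by auto
      ultimately show ?thesis using True fin(4) by auto
    next
      case False
      have "F = double_star ?a ?b" using False by (subst edges_decompose[OF F]) simp
      moreover have "F \<noteq> spiked_graph T" for T using False by auto
      moreover have "?a \<inter> ?b = {}" if "F = double_star P Q" "P \<inter> Q = {}" for P Q using that by simp
      ultimately show ?thesis using False fin(4,5) by auto
    qed
    finally show ?thesis .
  qed
qed

section \<open>Characteristic polynomials of contractions of the thagomizer\<close>

text \<open>Above a flat containing \<open>{A, B}\<close> only the spike set can grow, so the
  intervals are Boolean lattices.\<close>

lemma sum_flats_above_spiked_graph:
  assumes S: "finite S" and T: "T\<^sub>0 \<subseteq> T" "T \<subseteq> S"
  shows "(\<Sum>H \<in> {H \<in> flats (spiked_matroid S). spiked_graph T\<^sub>0 \<subseteq> H \<and> H \<subseteq> spiked_graph T}. f H) =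
    (\<Sum>W \<in> Pow (T - T\<^sub>0). f (spiked_graph (T\<^sub>0 \<union> W)))"
proof -
  have "{H \<in> flats (spiked_matroid S). spiked_graph T\<^sub>0 \<subseteq> H \<and> H \<subseteq> spiked_graph T} =
      spiked_graph ` {U. T\<^sub>0 \<subseteq> U \<and> U \<subseteq> T}" (is "?L = ?R")
  proof (intro set_eqI iffI)
    fix H assume "H \<in> ?L"
    then show "H \<in> ?R" by (auto simp: flats_spiked[OF S] subset_spiked_graph)
  next
    fix H assume "H \<in> ?R"
    then obtain U where U: "H = spiked_graph U" "T\<^sub>0 \<subseteq> U" "U \<subseteq> T" by auto
    then show "H \<in> ?L"
      using order_trans[OF U(3) T(2)] by (simp add: flats_spiked[OF S] subset_spiked_graph)
  qed
  moreover have "inj_on spiked_graph {U. T\<^sub>0 \<subseteq> U \<and> U \<subseteq> T}"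
    by (simp add: inj_on_def spiked_graph_eq_iff)
  ultimately show ?thesis
    by (simp add: sum.reindex sum_interval_eq_Pow[OF T(1)])
qed

text \<open>Subsets of the disjoint \<open>P\<close> and \<open>Q\<close> stay disjoint, so both
  spike sets grow independently and the interval is a product of two Boolean lattices.\<close>

lemma sum_flats_between_double_stars:
  assumes S: "finite S" and P: "P\<^sub>0 \<subseteq> P" "P \<subseteq> S" and Q: "Q\<^sub>0 \<subseteq> Q" "Q \<subseteq> S" and "P \<inter> Q = {}"
  shows "(\<Sum>H \<in> {H \<in> flats (spiked_matroid S). double_star P\<^sub>0 Q\<^sub>0 \<subseteq> H \<and> H \<subseteq> double_star P Q}. f H) =
    (\<Sum>X \<in> Pow (P - P\<^sub>0). \<Sum>Y \<in> Pow (Q - Q\<^sub>0). f (double_star (P\<^sub>0 \<union> X) (Q\<^sub>0 \<union> Y)))"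
proof -
  let ?I = "{U. P\<^sub>0 \<subseteq> U \<and> U \<subseteq> P} \<times> {V. Q\<^sub>0 \<subseteq> V \<and> V \<subseteq> Q}"
  have "{H \<in> flats (spiked_matroid S). double_star P\<^sub>0 Q\<^sub>0 \<subseteq> H \<and> H \<subseteq> double_star P Q} =
      (\<lambda>(U, V). double_star U V) ` ?I" (is "?L = ?R")
  proof (intro set_eqI iffI)
    fix H assume "H \<in> ?L"
    then show "H \<in> ?R" by (auto simp: flats_spiked[OF S] subset_spiked_graph)
  next
    fix H assume "H \<in> ?R"
    then obtain U V where H: "H = double_star U V" "P\<^sub>0 \<subseteq> U" "U \<subseteq> P" "Q\<^sub>0 \<subseteq> V" "V \<subseteq> Q" by auto
    then have "U \<subseteq> S" "V \<subseteq> S" "U \<inter> V = {}" using assms by auto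
    then show "H \<in> ?L" using H by (auto simp: flats_spiked[OF S] subset_spiked_graph)
  qed
  moreover have "inj_on (\<lambda>(U, V). double_star U V) ?I"
    by (auto simp: inj_on_def double_star_eq_iff)
  ultimately have "(\<Sum>H\<in>?L. f H) = (\<Sum>(U, V)\<in>?I. f (double_star U V))"
    by (simp add: sum.reindex case_prod_unfold)
  then show ?thesis
    by (simp add: sum_interval_eq_Pow[OF P(1)] sum_interval_eq_Pow[OF Q(1)]
        flip: sum.cartesian_product)
qed

text \<open>The two sums separate flats with and without \<open>{A, B}\<close>. In the latter each
  spike of \<open>D\<close> is joined to \<open>A\<close>, to \<open>B\<close> or to neither, whence
  the disjoint pairs \<open>X\<close>, \<open>Y\<close>.\<close>

lemma sum_flats_above_double_star:
  assumes S: "finite S" and T: "P\<^sub>0 \<subseteq> T" "Q\<^sub>0 \<subseteq> T" "T \<subseteq> S" and disj: "P\<^sub>0 \<inter> Q\<^sub>0 = {}"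
  defines "D \<equiv> T - (P\<^sub>0 \<union> Q\<^sub>0)"
  shows "(\<Sum>H \<in> {H \<in> flats (spiked_matroid S). double_star P\<^sub>0 Q\<^sub>0 \<subseteq> H \<and> H \<subseteq> spiked_graph T}. f H) =
    (\<Sum>W \<in> Pow D. f (spiked_graph (P\<^sub>0 \<union> Q\<^sub>0 \<union> W))) +
    (\<Sum>X \<in> Pow D. \<Sum>Y \<in> Pow (D - X). f (double_star (P\<^sub>0 \<union> X) (Q\<^sub>0 \<union> Y)))"
proof -
  let ?U = "{U. P\<^sub>0 \<union> Q\<^sub>0 \<subseteq> U \<and> U \<subseteq> T}" and ?I = "SIGMA X : Pow D. Pow (D - X)"
  let ?h = "\<lambda>(X, Y). double_star (P\<^sub>0 \<union> X) (Q\<^sub>0 \<union> Y)"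
  have finT: "finite T" using T S by (simp add: finite_subset)
  then have finD: "finite D" by (simp add: D_def)
  have "{H \<in> flats (spiked_matroid S). double_star P\<^sub>0 Q\<^sub>0 \<subseteq> H \<and> H \<subseteq> spiked_graph T} =
      spiked_graph ` ?U \<union> ?h ` ?I" (is "?L = ?R")
  proof (intro set_eqI iffI)
    fix H assume H: "H \<in> ?L"
    then consider U where "H = spiked_graph U" | P Q where "H = double_star P Q" "P \<inter> Q = {}"
      by (auto simp: flats_spiked[OF S])
    then show "H \<in> ?R"
    proof cases
      case 1
      then show ?thesis using H by (auto simp: subset_spiked_graph)
    next
      case 2
      then have "P\<^sub>0 \<subseteq> P" "Q\<^sub>0 \<subseteq> Q" "P \<subseteq> T" "Q \<subseteq> T" using H by (auto simp: subset_spiked_graph)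
      then have "H = ?h (P - P\<^sub>0, Q - Q\<^sub>0)" "(P - P\<^sub>0, Q - Q\<^sub>0) \<in> ?I"
        using 2 by (auto simp: D_def Un_absorb1)
      then show ?thesis by blast
    qed
  next
    fix H assume "H \<in> ?R"
    then consider U where "H = spiked_graph U" "U \<in> ?U"
      | X Y where "H = double_star (P\<^sub>0 \<union> X) (Q\<^sub>0 \<union> Y)" "X \<subseteq> D" "Y \<subseteq> D - X" by auto
    then show "H \<in> ?L"
    proof cases
      case 1
      then have "U \<subseteq> S" using T by auto
      with 1 show ?thesis by (auto simp: flats_spiked[OF S] subset_spiked_graph)
    next
      case 2
      then have "(P\<^sub>0 \<union> X) \<inter> (Q\<^sub>0 \<union> Y) = {}" "P\<^sub>0 \<union> X \<subseteq> T" "Q\<^sub>0 \<union> Y \<subseteq> T"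
        using T disj by (auto simp: D_def)
      moreover from this have "P\<^sub>0 \<union> X \<subseteq> S" "Q\<^sub>0 \<union> Y \<subseteq> S" using T(3) by auto
      ultimately show ?thesis
        unfolding 2(1) mem_Collect_eq flats_spiked[OF S] subset_spiked_graph by blast
    qed
  qed
  moreover have "spiked_graph ` ?U \<inter> ?h ` ?I = {}" by (auto simp: spiked_neq_double_star)
  moreover have "finite ?U" by (rule finite_subset[of _ "Pow T"]) (use finT in auto)
  moreover have "finite ?I" using finD by (intro finite_SigmaI) simp_all
  ultimately have "(\<Sum>H\<in>?L. f H) = (\<Sum>H\<in>spiked_graph ` ?U. f H) + (\<Sum>H\<in>?h ` ?I. f H)"
    by (simp only: finite_imageI sum.union_disjoint)
  also have "(\<Sum>H\<in>spiked_graph ` ?U. f H) = (\<Sum>U\<in>?U. f (spiked_graph U))"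
    by (subst sum.reindex) (simp_all add: inj_on_def spiked_graph_eq_iff)
  also have "\<dots> = (\<Sum>W \<in> Pow D. f (spiked_graph (P\<^sub>0 \<union> Q\<^sub>0 \<union> W)))"
    unfolding D_def using T by (intro sum_interval_eq_Pow) auto
  also have "(\<Sum>H\<in>?h ` ?I. f H) = (\<Sum>i\<in>?I. f (?h i))"
  proof (rule sum.reindex_cong[OF _ refl refl])
    show "inj_on ?h ?I"
    proof (rule inj_onI, clarify)
      fix X Y X' Y'
      assume *: "X \<subseteq> D" "Y \<subseteq> D - X" "X' \<subseteq> D" "Y' \<subseteq> D - X'"
        and "double_star (P\<^sub>0 \<union> X) (Q\<^sub>0 \<union> Y) = double_star (P\<^sub>0 \<union> X') (Q\<^sub>0 \<union> Y')"
      then have "P\<^sub>0 \<union> X = P\<^sub>0 \<union> X'" "Q\<^sub>0 \<union> Y = Q\<^sub>0 \<union> Y'" by (simp_all add: double_star_eq_iff)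
      moreover have "P\<^sub>0 \<inter> X = {}" "P\<^sub>0 \<inter> X' = {}" "Q\<^sub>0 \<inter> Y = {}" "Q\<^sub>0 \<inter> Y' = {}"
        using * by (auto simp: D_def)
      ultimately show "X = X' \<and> Y = Y'" by blast
    qed
  qed
  also have "\<dots> = (\<Sum>X \<in> Pow D. \<Sum>Y \<in> Pow (D - X). f (double_star (P\<^sub>0 \<union> X) (Q\<^sub>0 \<union> Y)))"
    using finD by (subst sum.Sigma) (simp_all add: case_prod_unfold)
  finally show ?thesis .
qed

section \<open>Reversed characteristic polynomials above the two kinds of flats\<close>

lemma flats_above_eq:
  "{G \<in> flats (spiked_matroid S). F \<subseteq> G} = {G \<in> flats (spiked_matroid S). F \<subseteq> G \<and> G \<subseteq> spiked_graph S}"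
  by (auto simp: flats_def)

text \<open>Once \<open>{A, B}\<close> is contracted, the two edges at each remaining spike are
  parallel, so the lattice of flats is Boolean on \<open>S - T\<^sub>0\<close>.\<close>

lemma reversal_char_poly_contraction_spiked_graph:
  assumes S: "finite S" and T\<^sub>0: "T\<^sub>0 \<subseteq> S"
  defines "C \<equiv> contraction (spiked_matroid S) (spiked_graph T\<^sub>0)"
  shows "reversal (rk C) (char_poly C) = [:1, -1:] ^ card (S - T\<^sub>0)"
proof -
  interpret finite_matroid "spiked_matroid S" using S by (rule finite_matroid_spiked)
  let ?g = "\<lambda>H. (-1::int) ^ card (A_spikes H - T\<^sub>0)"
  have diff: "T\<^sub>0 \<union> W - T\<^sub>0 = W" if "W \<in> Pow (T - T\<^sub>0)" for W T
    using that by auto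
  have "reversal (rk C) (char_poly C) = (\<Sum>G \<in> {G \<in> flats (spiked_matroid S). spiked_graph T\<^sub>0 \<subseteq> G}.
      monom (?g G) (r G - r (spiked_graph T\<^sub>0)))"
    unfolding C_def
  proof (rule reversal_char_poly_contraction)
    show "spiked_graph T\<^sub>0 \<in> flats (spiked_matroid S)" using T\<^sub>0 by (auto simp: flats_spiked[OF S])
    fix G assume G: "G \<in> flats (spiked_matroid S)" "spiked_graph T\<^sub>0 \<subset> G"
    then have T\<^sub>0G: "spiked_graph T\<^sub>0 \<subseteq> G" "spiked_graph T\<^sub>0 \<noteq> G" by auto
    from G(1) consider T where "G = spiked_graph T" "T \<subseteq> S" | P Q where "G = double_star P Q"
      unfolding flats_spiked[OF S] by blast
    then obtain T where T: "G = spiked_graph T" "T\<^sub>0 \<subset> T" "T \<subseteq> S"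
      using T\<^sub>0G by cases (simp_all add: subset_spiked_graph spiked_graph_eq_iff psubset_eq)
    have fin: "finite (T - T\<^sub>0)" using T S by (auto intro: finite_subset)
    have "(\<Sum>H | H \<in> flats (spiked_matroid S) \<and> spiked_graph T\<^sub>0 \<subseteq> H \<and> H \<subseteq> G. ?g H) =
        (\<Sum>W \<in> Pow (T - T\<^sub>0). (-1) ^ card W)"
      unfolding T(1) sum_flats_above_spiked_graph[OF S psubset_imp_subset[OF T(2)] T(3)]
      by (intro sum.cong refl) (simp only: spikes_spiked_graph diff)
    also have "\<dots> = 0"
      using T fin by (simp add: sum_Pow_power_1 card_gt_0_iff)
    finally show "(\<Sum>H | H \<in> flats (spiked_matroid S) \<and> spiked_graph T\<^sub>0 \<subseteq> H \<and> H \<subseteq> G. ?g H) = 0" .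
  qed simp
  also have "\<dots> = (\<Sum>W \<in> Pow (S - T\<^sub>0). [:0, -1:] ^ card W)"
    unfolding flats_above_eq sum_flats_above_spiked_graph[OF S T\<^sub>0 order_refl]
  proof (intro sum.cong refl)
    fix W assume W: "W \<in> Pow (S - T\<^sub>0)"
    then have sub: "T\<^sub>0 \<union> W \<subseteq> S" using T\<^sub>0 by auto
    have "card (T\<^sub>0 \<union> W) = card T\<^sub>0 + card W"
      using W finite_subset[OF sub S] by (intro card_Un_disjoint) auto
    then show "monom (?g (spiked_graph (T\<^sub>0 \<union> W))) (r (spiked_graph (T\<^sub>0 \<union> W)) - r (spiked_graph T\<^sub>0))
        = [:0, -1:] ^ card W"
      unfolding rk_restriction_spiked_graph[OF S sub] rk_restriction_spiked_graph[OF S T\<^sub>0]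
      by (simp add: diff[OF W] monom_power_eq)
  qed
  also have "\<dots> = [:1, -1:] ^ card (S - T\<^sub>0)"
    using S by (simp add: sum_Pow_power_1 one_pCons)
  finally show ?thesis .
qed

text \<open>Contracting an edge at a spike merges the spike with \<open>A\<close> or
  \<open>B\<close> and makes its other edge parallel to \<open>{A, B}\<close>. Up to parallel edges
  the thagomizer on the remaining \<open>m\<close> spikes is left, with characteristic polynomial
  \<open>(t - 1) (t - 2)^m\<close>.\<close>

lemma reversal_char_poly_contraction_double_star:
  assumes S: "finite S" and P\<^sub>0: "P\<^sub>0 \<subseteq> S" and Q\<^sub>0: "Q\<^sub>0 \<subseteq> S" and disj: "P\<^sub>0 \<inter> Q\<^sub>0 = {}"
  defines "C \<equiv> contraction (spiked_matroid S) (double_star P\<^sub>0 Q\<^sub>0)"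
  shows "reversal (rk C) (char_poly C) = [:1, -1:] * [:1, -2:] ^ card (S - (P\<^sub>0 \<union> Q\<^sub>0))"
proof -
  interpret finite_matroid "spiked_matroid S" using S by (rule finite_matroid_spiked)
  \<comment> \<open>the Moebius function of the interval above \<open>double_star P\<^sub>0 Q\<^sub>0\<close>; the value \<open>-(-2)\<^sup>m\<close> is the
    constant term of \<open>(t - 1) (t - 2)\<^sup>m\<close>\<close>
  let ?g = "\<lambda>H. if {A, B} \<in> H then - ((-2::int) ^ card (A_spikes H - (P\<^sub>0 \<union> Q\<^sub>0)))
    else (-1) ^ card (A_spikes H - P\<^sub>0) * (-1) ^ card (B_spikes H - Q\<^sub>0)"
  let ?F = "double_star P\<^sub>0 Q\<^sub>0"
  have g_graph: "?g (spiked_graph (P\<^sub>0 \<union> Q\<^sub>0 \<union> W)) = - ((-2) ^ card W)" if "W \<inter> (P\<^sub>0 \<union> Q\<^sub>0) = {}" for W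
  proof -
    have "P\<^sub>0 \<union> Q\<^sub>0 \<union> W - (P\<^sub>0 \<union> Q\<^sub>0) = W" using that by auto
    then show ?thesis by (simp only: spikes_spiked_graph if_True)
  qed
  have g_star: "?g (double_star (P\<^sub>0 \<union> X) (Q\<^sub>0 \<union> Y)) = (-1) ^ card X * (-1) ^ card Y"
    if "X \<inter> P\<^sub>0 = {}" "Y \<inter> Q\<^sub>0 = {}" for X Y
  proof -
    have "P\<^sub>0 \<union> X - P\<^sub>0 = X" "Q\<^sub>0 \<union> Y - Q\<^sub>0 = Y" using that by auto
    then show ?thesis by (simp only: spikes_double_star if_False)
  qed
  have "reversal (rk C) (char_poly C) = (\<Sum>G \<in> {G \<in> flats (spiked_matroid S). ?F \<subseteq> G}.
      monom (?g G) (r G - r ?F))"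
    unfolding C_def
  proof (rule reversal_char_poly_contraction)
    show "?F \<in> flats (spiked_matroid S)" using assms by (auto simp: flats_spiked[OF S])
    fix G assume G: "G \<in> flats (spiked_matroid S)" "?F \<subset> G"
    then have FG: "?F \<subseteq> G" "?F \<noteq> G" by auto
    from G(1) consider T where "G = spiked_graph T" "T \<subseteq> S"
      | P Q where "G = double_star P Q" "P \<subseteq> S" "Q \<subseteq> S" "P \<inter> Q = {}"
      unfolding flats_spiked[OF S] by blast
    then consider T where "G = spiked_graph T" "P\<^sub>0 \<subseteq> T" "Q\<^sub>0 \<subseteq> T" "T \<subseteq> S"
      | P Q where "G = double_star P Q" "P\<^sub>0 \<subseteq> P" "Q\<^sub>0 \<subseteq> Q" "P \<subseteq> S" "Q \<subseteq> S" "P \<inter> Q = {}"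
        "P\<^sub>0 \<noteq> P \<or> Q\<^sub>0 \<noteq> Q"
      using FG by cases (simp_all add: subset_spiked_graph double_star_eq_iff)
    then show "(\<Sum>H | H \<in> flats (spiked_matroid S) \<and> ?F \<subseteq> H \<and> H \<subseteq> G. ?g H) = 0"
    proof cases
      case (1 T)
      let ?D = "T - (P\<^sub>0 \<union> Q\<^sub>0)"
      have fin: "finite ?D" using 1 S by (auto intro: finite_subset)
      have "(\<Sum>H | H \<in> flats (spiked_matroid S) \<and> ?F \<subseteq> H \<and> H \<subseteq> G. ?g H) =
          (\<Sum>W \<in> Pow ?D. - ((-2) ^ card W)) +
          (\<Sum>X \<in> Pow ?D. \<Sum>Y \<in> Pow (?D - X). (-1) ^ card X * (-1) ^ card Y)"
        unfolding 1(1) sum_flats_above_double_star[OF S 1(2-4) disj]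
        by (intro arg_cong2[where f = "(+)"] sum.cong refl g_graph g_star) auto
      \<comment> \<open>The flats with \<open>{A, B}\<close> sum to
        \<open>-(1 - 2) ^ card ?D\<close>. In the others the sum over \<open>Y\<close> is
        \<open>0 ^ card (?D - X)\<close>, which leaves only \<open>X = ?D\<close>; the two
        contributions cancel.\<close>
      also have "(\<Sum>W \<in> Pow ?D. - ((-2::int) ^ card W)) = - ((-1) ^ card ?D)"
        using fin by (simp add: sum_negf sum_Pow_power_1)
      also have "(\<Sum>X \<in> Pow ?D. \<Sum>Y \<in> Pow (?D - X). (-1::int) ^ card X * (-1) ^ card Y) =
          (\<Sum>X \<in> Pow ?D. (-1) ^ card X * 0 ^ card (?D - X))"
        using fin by (simp add: sum_Pow_power_1 flip: sum_distrib_left)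
      also have "\<dots> = (-1) ^ card ?D"
        by (simp only: sum_Pow_power[OF fin] add_0_right)
      finally show ?thesis by simp
    next
      case (2 P Q)
      have fin: "finite (P - P\<^sub>0)" "finite (Q - Q\<^sub>0)" using 2 S by (auto intro: finite_subset)
      have "(\<Sum>H | H \<in> flats (spiked_matroid S) \<and> ?F \<subseteq> H \<and> H \<subseteq> G. ?g H) =
          (\<Sum>X \<in> Pow (P - P\<^sub>0). \<Sum>Y \<in> Pow (Q - Q\<^sub>0). (-1) ^ card X * (-1) ^ card Y)"
        unfolding 2(1) sum_flats_between_double_stars[OF S 2(2,4,3,5,6)]
        by (intro sum.cong refl g_star) auto
      also have "\<dots> = 0 ^ card (P - P\<^sub>0) * 0 ^ card (Q - Q\<^sub>0)"
        using fin by (simp add: sum_Pow_power_1 flip: sum_product)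
      also have "\<dots> = 0"
        using 2 fin by (auto simp: power_0_left)
      finally show ?thesis .
    qed
  qed simp
  \<comment> \<open>The rank of a flat with \<open>{A, B}\<close> exceeds its number of spikes by
    one; this and the minus sign in \<open>?g\<close> give the factor \<open>-t\<close>.\<close>
  also have "\<dots> = (\<Sum>W \<in> Pow (S - (P\<^sub>0 \<union> Q\<^sub>0)). [:0, -1:] * [:0, -2:] ^ card W) +
      (\<Sum>X \<in> Pow (S - (P\<^sub>0 \<union> Q\<^sub>0)). \<Sum>Y \<in> Pow (S - (P\<^sub>0 \<union> Q\<^sub>0) - X). [:0, -1:] ^ card X * [:0, -1:] ^ card Y)"
    unfolding flats_above_eq sum_flats_above_double_star[OF S P\<^sub>0 Q\<^sub>0 order_refl disj]
      rk_restriction_double_star[OF S P\<^sub>0 Q\<^sub>0 disj]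
  proof (intro arg_cong2[where f = "(+)"] sum.cong refl)
    fix W assume W: "W \<in> Pow (S - (P\<^sub>0 \<union> Q\<^sub>0))"
    then have sub: "P\<^sub>0 \<union> Q\<^sub>0 \<union> W \<subseteq> S" and dis: "W \<inter> (P\<^sub>0 \<union> Q\<^sub>0) = {}" using P\<^sub>0 Q\<^sub>0 by auto
    have "card (P\<^sub>0 \<union> Q\<^sub>0 \<union> W) = card P\<^sub>0 + card Q\<^sub>0 + card W"
      using W disj finite_subset[OF sub S] by (subst card_Un_disjoint; (subst card_Un_disjoint)?) auto
    then show "monom (?g (spiked_graph (P\<^sub>0 \<union> Q\<^sub>0 \<union> W)))
        (r (spiked_graph (P\<^sub>0 \<union> Q\<^sub>0 \<union> W)) - (card P\<^sub>0 + card Q\<^sub>0)) = [:0, -1:] * [:0, -2:] ^ card W"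
      unfolding rk_restriction_spiked_graph[OF S sub] g_graph[OF dis]
      by (simp add: monom_Suc monom_power_eq flip: minus_monom)
  next
    fix X Y assume XY: "X \<in> Pow (S - (P\<^sub>0 \<union> Q\<^sub>0))" "Y \<in> Pow (S - (P\<^sub>0 \<union> Q\<^sub>0) - X)"
    then have sub: "P\<^sub>0 \<union> X \<subseteq> S" "Q\<^sub>0 \<union> Y \<subseteq> S" and dis: "(P\<^sub>0 \<union> X) \<inter> (Q\<^sub>0 \<union> Y) = {}"
      and dis': "X \<inter> P\<^sub>0 = {}" "Y \<inter> Q\<^sub>0 = {}" using P\<^sub>0 Q\<^sub>0 disj by auto
    have "card (P\<^sub>0 \<union> X) = card P\<^sub>0 + card X"
      using dis' finite_subset[OF sub(1) S] by (intro card_Un_disjoint) auto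
    moreover have "card (Q\<^sub>0 \<union> Y) = card Q\<^sub>0 + card Y"
      using dis' finite_subset[OF sub(2) S] by (intro card_Un_disjoint) auto
    ultimately show "monom (?g (double_star (P\<^sub>0 \<union> X) (Q\<^sub>0 \<union> Y)))
        (r (double_star (P\<^sub>0 \<union> X) (Q\<^sub>0 \<union> Y)) - (card P\<^sub>0 + card Q\<^sub>0)) = [:0, -1:] ^ card X * [:0, -1:] ^ card Y"
      unfolding rk_restriction_double_star[OF S sub dis] g_star[OF dis']
      by (simp add: monom_power_eq flip: power_add)
  qed
  also have "(\<Sum>W \<in> Pow (S - (P\<^sub>0 \<union> Q\<^sub>0)). [:0, -1:] * [:0, -2:] ^ card W) =
      [:0, -1::int:] * [:1, -2:] ^ card (S - (P\<^sub>0 \<union> Q\<^sub>0))"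
    unfolding sum_distrib_left[symmetric] using S by (subst sum_Pow_power_1) (simp_all add: one_pCons)
  also have "(\<Sum>X \<in> Pow (S - (P\<^sub>0 \<union> Q\<^sub>0)). \<Sum>Y \<in> Pow (S - (P\<^sub>0 \<union> Q\<^sub>0) - X). [:0, -1::int:] ^ card X * [:0, -1:] ^ card Y) =
      (\<Sum>X \<in> Pow (S - (P\<^sub>0 \<union> Q\<^sub>0)). [:0, -1:] ^ card X * [:1, -1:] ^ card (S - (P\<^sub>0 \<union> Q\<^sub>0) - X))"
    using S by (simp add: sum_Pow_power_1 one_pCons flip: sum_distrib_left)
  also have "\<dots> = [:1, -2:] ^ card (S - (P\<^sub>0 \<union> Q\<^sub>0))"
    using S by (subst sum_Pow_power) simp_all
  also have "[:0, -1::int:] * [:1, -2:] ^ card (S - (P\<^sub>0 \<union> Q\<^sub>0)) + [:1, -2:] ^ card (S - (P\<^sub>0 \<union> Q\<^sub>0)) =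
      ([:0, -1:] + 1) * [:1, -2:] ^ card (S - (P\<^sub>0 \<union> Q\<^sub>0))"
    by (simp only: distrib_right mult_1_left)
  also have "[:0, -1::int:] + 1 = [:1, -1:]" by (simp add: one_pCons)
  finally show ?thesis .
qed

section \<open>Ballot polynomials\<close>

text \<open>Serves to reverse the ballot polynomial of a subset of the spikes at the rank belonging
  to all spikes.\<close>

lemma reversal_add_left:
  fixes p :: "'a::comm_semiring_1 poly"
  assumes "degree p \<le> r"
  shows "reversal (d + r) p = [:0, 1:] ^ d * reversal r p"
proof -
  have "monom (1::'a) (d + r - degree p) = [:0, 1:] ^ d * monom 1 (r - degree p)"
    using assms mult_monom[of "1::'a" d 1 "r - degree p"] monom_power_eq[of "1::'a" d] by simp
  then show ?thesis by (simp only: reversal_def mult.assoc)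
qed

lemma reversal_sum:
  assumes "\<And>i. i \<in> I \<Longrightarrow> degree (p i) \<le> r"
  shows "reversal r (\<Sum>i\<in>I. p i) = (\<Sum>i\<in>I. reversal r (p i))"
proof (cases "finite I")
  case True
  then have "degree (\<Sum>i\<in>I. p i) \<le> r" using assms by (intro degree_sum_le)
  then show ?thesis using assms by (intro poly_eqI) (auto simp: coeff_reversal coeff_sum)
qed (simp add: reversal_def)

text \<open>The coefficients of \<open>(1 - t) (1 + t)^u\<close>, which are the ballot numbers for
  \<open>2 * k \<le> u\<close>. The type is \<open>int\<close> because they turn negative beyond the
  middle.\<close>

definition ballot :: "nat \<Rightarrow> nat \<Rightarrow> int" where
  "ballot u k = int (u choose k) - (case k of 0 \<Rightarrow> 0 | Suc j \<Rightarrow> int (u choose j))"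

lemma coeff_one_plus_X_power: "coeff ([:1, 1:] ^ u :: int poly) k = int (u choose k)"
proof (induction u arbitrary: k)
  case 0
  then show ?case by (cases k) auto
next
  case (Suc u)
  then show ?case by (cases k) (simp_all add: coeff_pCons)
qed

lemma coeff_ballot: "coeff ([:1, -1:] * [:1, 1:] ^ u) k = ballot u k"
  by (cases k) (simp_all add: ballot_def coeff_pCons coeff_one_plus_X_power)

text \<open>\<open>1 - t\<close> is antipalindromic and \<open>(1 + t)^u\<close> palindromic; on
  coefficients this is the symmetry of the binomial coefficients.\<close>

lemma ballot_antisym:
  assumes "k \<le> Suc u"
  shows "ballot u (Suc u - k) = - ballot u k"
proof (cases k)
  case (Suc j)
  then have j: "j \<le> u" using assms by simp
  show ?thesis
  proof (cases "u - j")
    case 0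
    then show ?thesis using j Suc by (simp add: ballot_def)
  next
    case (Suc i)
    then have "Suc j \<le> u" "u - Suc j = i" by simp_all
    then have "u choose Suc j = u choose i" "u choose j = u choose Suc i"
      using j Suc binomial_symmetric[of "Suc j" u] binomial_symmetric[of j u] by simp_all
    then show ?thesis using Suc \<open>k = Suc j\<close> by (simp add: ballot_def)
  qed
qed (simp add: ballot_def)

text \<open>The terms of degree at most \<open>u / 2\<close> of the antipalindromic polynomial \<open>(1 - t) (1 + t)\<^sup>u\<close>.\<close>

definition ballot_poly :: "nat \<Rightarrow> int poly" where
  "ballot_poly u = (\<Sum>k\<le>u div 2. monom (ballot u k) k)"

lemma coeff_ballot_poly: "coeff (ballot_poly u) k = (if 2 * k \<le> u then ballot u k else 0)"
  by (auto simp: ballot_poly_def coeff_sum)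

lemma degree_ballot_poly: "degree (ballot_poly u) \<le> u div 2"
  by (rule degree_le) (auto simp: coeff_ballot_poly)

text \<open>Reversal carries the lower half of \<open>(1 - t) (1 + t)^u\<close> to the negative of
  its upper half, so the difference of the two is the whole polynomial.\<close>

lemma reversal_ballot_poly:
  "reversal (Suc u) (ballot_poly u) = ballot_poly u - [:1, -1:] * [:1, 1:] ^ u"
proof (rule poly_eqI)
  fix k
  have deg: "degree (ballot_poly u) \<le> Suc u" using degree_ballot_poly[of u] by simp
  have "(if k \<le> Suc u then coeff (ballot_poly u) (Suc u - k) else 0) = coeff (ballot_poly u) k - ballot u k"
  proof (cases "k \<le> Suc u")
    case True
    note anti = ballot_antisym[OF True]
    consider "2 * k \<le> u" | "2 * k = Suc u" | "2 * k > Suc u" by linarith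
    then show ?thesis
    proof cases
      \<comment> \<open>The middle coefficient is its own negative, hence 0, so omitting it from
        both halves is harmless.\<close>
      case 2
      then have "Suc u - k = k" by simp
      then show ?thesis using anti 2 by (simp add: coeff_ballot_poly)
    qed (use True anti in \<open>simp_all add: coeff_ballot_poly\<close>)
  next
    case False
    then show ?thesis by (simp add: coeff_ballot_poly ballot_def binomial_eq_0 split: nat.split)
  qed
  then show "coeff (reversal (Suc u) (ballot_poly u)) k =
      coeff (ballot_poly u - [:1, -1:] * [:1, 1:] ^ u) k"
    unfolding coeff_diff coeff_ballot coeff_reversal[OF deg] .
qed

section \<open>Subset sums and multinomial coefficients\<close>

lemma sum_Pow_card:
  fixes f :: "nat \<Rightarrow> 'a::comm_semiring_1"
  assumes "finite S"
  shows "(\<Sum>U\<in>Pow S. f (card U)) = (\<Sum>s\<le>card S. of_nat (card S choose s) * f s)"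
proof -
  have "(\<Sum>U\<in>Pow S. f (card U)) = (\<Sum>s\<le>card S. \<Sum>U\<in>{U \<in> Pow S. card U = s}. f (card U))"
    using assms by (intro sum.group[symmetric]) (auto intro: card_mono)
  also have "\<dots> = (\<Sum>s\<le>card S. \<Sum>U\<in>{U. U \<subseteq> S \<and> card U = s}. f s)"
    by (intro sum.cong) auto
  finally show ?thesis by (simp add: n_subsets[OF assms])
qed

text \<open>The ballot number is \<open>(s - 2 k + 1) s! / (k! (s - k + 1)!)\<close>; its
  \<open>s!\<close> cancels against the denominator of \<open>n choose s\<close>.\<close>

lemma binomial_times_ballot:
  assumes "2 * k \<le> s" "s \<le> n"
  shows "of_nat (n choose s) * of_int (ballot s k) =
    (of_nat (s - 2 * k + 1) / of_nat (n + 1) *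
      (fact (n + 1) / (fact k * fact (n - s) * fact (s - k + 1))) :: 'a::field_char_0)"
proof -
  have ballot: "of_int (ballot s k) = of_nat (s - 2 * k + 1) * fact s / (fact k * fact (s - k + 1) :: 'a)"
  proof (cases k)
    case 0
    then show ?thesis by (simp add: ballot_def divide_simps del: of_nat_Suc)
  next
    case (Suc j)
    \<comment> \<open>Writing \<open>s = m + 2 * k\<close> removes the truncated
      subtractions.\<close>
    define m where "m = s - 2 * k"
    have s: "s = m + 2 * k" using assms by (simp add: m_def)
    have le: "k \<le> s" "j \<le> s" using s Suc by simp_all
    have e: "s - k = m + k" "s - j = Suc (m + k)" "s - 2 * k = m" using s Suc by simp_all
    have "of_int (ballot s k) = (of_nat (s choose k) - of_nat (s choose j) :: 'a)"
      using Suc by (simp add: ballot_def)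
    also have "of_nat (s choose k) = (fact s / (fact k * fact (m + k)) :: 'a)"
      by (simp only: binomial_fact[OF le(1)] e)
    also have "of_nat (s choose j) = (fact s / (fact j * fact (Suc (m + k))) :: 'a)"
      by (simp only: binomial_fact[OF le(2)] e)
    also have "fact s / (fact k * fact (m + k)) - fact s / (fact j * fact (Suc (m + k))) =
        (of_nat (m + 1) * fact s / (fact k * fact (Suc (m + k))) :: 'a)"
    proof -
      \<comment> \<open>Over the common denominator each fraction lacks one of the factors
        \<open>x = k\<close> and \<open>y = s - k + 1\<close>, so the numerator is
        \<open>y - x = m + 1\<close>.\<close>
      define x y :: 'a where "x = of_nat k" and "y = of_nat (Suc (m + k))"
      have eqs: "fact k = x * fact j" "fact (Suc (m + k)) = y * fact (m + k)" "of_nat (m + 1) = y - x"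
        by (simp_all add: x_def y_def Suc)
      have "x \<noteq> 0" "y \<noteq> 0"
        unfolding x_def y_def Suc by (rule of_nat_neq_0)+
      then show ?thesis unfolding eqs by (simp add: field_simps)
    qed
    finally show ?thesis by (simp only: e Suc_eq_plus1)
  qed
  have "fact (n + 1) = of_nat (n + 1) * (fact n :: 'a)" by simp
  moreover have "of_nat (n choose s) = (fact n / (fact s * fact (n - s)) :: 'a)"
    using assms by (subst binomial_fact) simp_all
  ultimately show ?thesis
    unfolding ballot by (simp del: of_nat_Suc of_nat_add fact_Suc add: mult_ac)
qed

section \<open>The inverse Kazhdan--Lusztig polynomial\<close>

text \<open>The defining identity with all weights inserted; the first sum comes from flats with
  \<open>{A, B}\<close>, the second from the others. The left side and the first sum differ by
  \<open>(1 - t) (1 + 2 t)^n\<close> up to sign, and the second sum makes up for it.\<close>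

lemma spiked_inverse_KL_equation:
  assumes S: "finite S"
  shows "(-1) ^ Suc (card S) * reversal (Suc (card S)) (\<Sum>U\<in>Pow S. ballot_poly (card U)) =
    (\<Sum>T\<in>Pow S. (-1) ^ Suc (card T) * (\<Sum>U\<in>Pow T. ballot_poly (card U)) * [:1, -1:] ^ card (S - T)) +
    (\<Sum>P\<in>Pow S. \<Sum>Q\<in>Pow (S - P). (-1) ^ (card P + card Q) * ([:1, -1:] * [:1, -2:] ^ card (S - (P \<union> Q))))"
proof -
  let ?n = "card S" and ?R = "\<lambda>U. ballot_poly (card U)"
  have card_diff: "card S = card (S - U) + card U" if "U \<in> Pow S" for U
    using that S by (simp add: card_Diff_subset card_mono finite_subset)
  have "reversal (Suc ?n) (\<Sum>U\<in>Pow S. ?R U) = (\<Sum>U\<in>Pow S. reversal (Suc ?n) (?R U))"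
  proof (rule reversal_sum)
    fix U assume "U \<in> Pow S"
    then show "degree (?R U) \<le> Suc ?n"
      using degree_ballot_poly[of "card U"] card_diff[of U] by simp
  qed
  also have "\<dots> = (\<Sum>U\<in>Pow S. [:0, 1:] ^ card (S - U) * ?R U -
      [:1, -1:] * ([:1, 1:] ^ card U * [:0, 1:] ^ card (S - U)))"
  proof (rule sum.cong[OF refl])
    fix U assume U: "U \<in> Pow S"
    have "degree (?R U) \<le> Suc (card U)" using degree_ballot_poly[of "card U"] by simp
    \<comment> \<open>The order is split as \<open>card (S - U) + Suc (card U)\<close>, the second
      summand being the one at which \<open>?R U\<close> has its symmetry.\<close>
    then have "reversal (Suc ?n) (?R U) = [:0, 1:] ^ card (S - U) * reversal (Suc (card U)) (?R U)"
      using reversal_add_left[of "?R U" "Suc (card U)" "card (S - U)"] card_diff[OF U] by simp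
    then show "reversal (Suc ?n) (?R U) = [:0, 1:] ^ card (S - U) * ?R U -
        [:1, -1:] * ([:1, 1:] ^ card U * [:0, 1:] ^ card (S - U))"
      unfolding reversal_ballot_poly right_diff_distrib by (simp only: mult_ac)
  qed
  also have "\<dots> = (\<Sum>U\<in>Pow S. [:0, 1:] ^ card (S - U) * ?R U) - [:1, -1:] * [:1, 2:] ^ ?n"
    unfolding sum_subtractf sum_distrib_left[symmetric] sum_Pow_power[OF S] by simp
  finally have lhs: "reversal (Suc ?n) (\<Sum>U\<in>Pow S. ?R U) =
    (\<Sum>U\<in>Pow S. [:0, 1:] ^ card (S - U) * ?R U) - [:1, -1:] * [:1, 2:] ^ ?n" .

  have "(\<Sum>T\<in>Pow S. (-1) ^ Suc (card T) * (\<Sum>U\<in>Pow T. ?R U) * [:1, -1:] ^ card (S - T)) =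
      (\<Sum>T\<in>Pow S. \<Sum>U | U \<in> Pow S \<and> U \<subseteq> T. (-1) ^ Suc (card T) * ?R U * [:1, -1:] ^ card (S - T))"
    unfolding sum_distrib_left sum_distrib_right by (intro sum.cong refl) auto
  \<comment> \<open>With \<open>U\<close> outermost, \<open>T\<close> runs through the interval from
    \<open>U\<close> to \<open>S\<close> and contributes a power of
    \<open>-1 + (1 - t)\<close>.\<close>
  also have "\<dots> = (\<Sum>U\<in>Pow S. \<Sum>T | T \<in> Pow S \<and> U \<subseteq> T. (-1) ^ Suc (card T) * ?R U * [:1, -1:] ^ card (S - T))"
    using S by (intro sum.swap_restrict) simp_all
  also have "\<dots> = (\<Sum>U\<in>Pow S. (-1) ^ Suc ?n * ([:0, 1:] ^ card (S - U) * ?R U))"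
  proof (rule sum.cong[OF refl])
    fix U assume U: "U \<in> Pow S"
    have "{T. T \<in> Pow S \<and> U \<subseteq> T} = {T. U \<subseteq> T \<and> T \<subseteq> S}" by auto
    then have "(\<Sum>T | T \<in> Pow S \<and> U \<subseteq> T. (-1) ^ Suc (card T) * ?R U * [:1, -1:] ^ card (S - T)) =
        (\<Sum>V\<in>Pow (S - U). (-1) ^ Suc (card (U \<union> V)) * ?R U * [:1, -1:] ^ card (S - (U \<union> V)))"
      using U by (simp only: sum_interval_eq_Pow Pow_iff)
    also have "\<dots> = (\<Sum>V\<in>Pow (S - U). (-1) ^ Suc (card U) * ?R U * ((-1) ^ card V * [:1, -1:] ^ card (S - U - V)))"
    proof (rule sum.cong[OF refl])
      fix V assume V: "V \<in> Pow (S - U)"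
      have "card (U \<union> V) = card U + card V"
        using U V S by (intro card_Un_disjoint) (auto intro: finite_subset)
      moreover have "S - (U \<union> V) = S - U - V" by auto
      ultimately show "(-1) ^ Suc (card (U \<union> V)) * ?R U * [:1, -1:] ^ card (S - (U \<union> V)) =
          (-1) ^ Suc (card U) * ?R U * ((-1) ^ card V * [:1, -1:] ^ card (S - U - V))"
        by (simp only: power_add power_Suc mult_ac)
    qed
    also have "\<dots> = (-1) ^ Suc (card U) * ?R U * (-1 + [:1, -1:]) ^ card (S - U)"
      unfolding sum_distrib_left[symmetric] using S by (subst sum_Pow_power) simp_all
    \<comment> \<open>Splitting off -1 merges the signs with exponents \<open>Suc (card U)\<close>
      and \<open>card (S - U)\<close> into one that does not depend on \<open>U\<close>.\<close>
    also have "-1 + [:1, -1:] = -1 * [:0, 1::int:]" by (simp add: one_pCons)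
    also have "(-1) ^ Suc (card U) * ?R U * (-1 * [:0, 1:]) ^ card (S - U) =
        (-1) ^ Suc ?n * ([:0, 1:] ^ card (S - U) * ?R U)"
      unfolding card_diff[OF U] power_mult_distrib by (simp only: power_add power_Suc mult_ac)
    finally show "(\<Sum>T | T \<in> Pow S \<and> U \<subseteq> T. (-1) ^ Suc (card T) * ?R U * [:1, -1:] ^ card (S - T)) =
        (-1) ^ Suc ?n * ([:0, 1:] ^ card (S - U) * ?R U)" .
  qed
  finally have rhs1: "(\<Sum>T\<in>Pow S. (-1) ^ Suc (card T) * (\<Sum>U\<in>Pow T. ?R U) * [:1, -1:] ^ card (S - T)) =
      (-1) ^ Suc ?n * (\<Sum>U\<in>Pow S. [:0, 1:] ^ card (S - U) * ?R U)"
    by (simp only: sum_distrib_left)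

  have diff_Un: "S - (P \<union> Q) = S - P - Q" for P Q by auto
  \<comment> \<open>Each spike is joined to \<open>A\<close>, to \<open>B\<close> or to neither,
    with weights \<open>-1\<close>, \<open>-1\<close> and \<open>1 - 2 t\<close>; each spike thus
    contributes their sum as a factor.\<close>
  have "(\<Sum>P\<in>Pow S. \<Sum>Q\<in>Pow (S - P). (-1) ^ (card P + card Q) * ([:1, -1:] * [:1, -2:] ^ card (S - (P \<union> Q)))) =
      (\<Sum>P\<in>Pow S. [:1, -1:] * ((-1) ^ card P * (\<Sum>Q\<in>Pow (S - P). (-1) ^ card Q * [:1, -2:] ^ card (S - P - Q))))"
    unfolding sum_distrib_left by (simp only: diff_Un power_add mult_ac)
  also have "\<dots> = [:1, -1:] * (\<Sum>P\<in>Pow S. (-1) ^ card P * (-1 + [:1, -2:]) ^ card (S - P))"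
    unfolding sum_distrib_left[symmetric] using S by (simp add: sum_Pow_power)
  also have "\<dots> = [:1, -1:] * (-1 + (-1 + [:1, -2:])) ^ ?n"
    by (simp only: sum_Pow_power[OF S])
  also have "-1 + (-1 + [:1, -2:]) = -1 * [:1, 2::int:]" by (simp add: one_pCons)
  also have "[:1, -1:] * (-1 * [:1, 2::int:]) ^ ?n = - ((-1) ^ Suc ?n * ([:1, -1:] * [:1, 2:] ^ ?n))"
    unfolding power_mult_distrib by (simp only: power_Suc mult_ac mult_minus_left mult_1_left minus_minus)
  finally show ?thesis
    unfolding lhs rhs1 right_diff_distrib by (simp only: diff_conv_add_uminus)
qed

text \<open>The candidate is tested in the recursion, where every proper restriction to a flat is a
  smaller spiked matroid or a Boolean one.\<close>

lemma inverse_KL_spiked: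
  assumes "finite S"
  shows "inverse_KL (spiked_matroid S) = (\<Sum>U\<in>Pow S. ballot_poly (card U))"
  using assms
proof (induction S rule: finite_psubset_induct)
  case (psubset S)
  note S = psubset.hyps
  interpret finite_matroid "spiked_matroid S" using S by (rule finite_matroid_spiked)
  let ?M = "spiked_matroid S" and ?q = "\<Sum>U\<in>Pow S. ballot_poly (card U)"
  let ?f = "\<lambda>F. (-1) ^ r F * (if F = ground ?M then ?q else inverse_KL (restriction ?M F)) *
    reversal (rk (contraction ?M F)) (char_poly (contraction ?M F))"
  show ?case
  proof (rule inverse_KL_eqI)
    show "rk ?M \<noteq> 0" by (simp add: rk_spiked[OF S])
    have "degree ?q \<le> card S div 2"
    proof (rule degree_sum_le)
      fix U assume "U \<in> Pow S"
      then have "card U \<le> card S" using S by (auto intro: card_mono)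
      then show "degree (ballot_poly (card U)) \<le> card S div 2"
        using degree_ballot_poly[of "card U"] by (meson div_le_mono order_trans)
    qed (use S in simp)
    \<comment> \<open>\<open>2 * (card S div 2) \<le> card S\<close> lies strictly below the rank
      \<open>card S + 1\<close> for either parity.\<close>
    then show "2 * degree ?q < rk ?M" by (simp add: rk_spiked[OF S])
    \<comment> \<open>The empty double star is the least flat, so the sum over flats above a double
      star covers all flats.\<close>
    have "double_star {} {} = {}" by (simp add: double_star_def)
    then have "flats ?M = {H \<in> flats ?M. double_star {} {} \<subseteq> H \<and> H \<subseteq> spiked_graph S}"
      by (auto simp: flats_def)
    then have "(\<Sum>F\<in>flats ?M. ?f F) = (\<Sum>F\<in>{H \<in> flats ?M. double_star {} {} \<subseteq> H \<and> H \<subseteq> spiked_graph S}. ?f F)"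
      by (rule sum.cong) (rule refl)
    also have "\<dots> = (\<Sum>T\<in>Pow S. ?f (spiked_graph T)) + (\<Sum>P\<in>Pow S. \<Sum>Q\<in>Pow (S - P). ?f (double_star P Q))"
      using sum_flats_above_double_star[OF S, of "{}" S "{}" ?f] by (simp only: Un_empty_left Diff_empty) simp
    also have "(\<Sum>T\<in>Pow S. ?f (spiked_graph T)) =
      (\<Sum>T\<in>Pow S. (-1) ^ Suc (card T) * (\<Sum>U\<in>Pow T. ballot_poly (card U)) * [:1, -1:] ^ card (S - T))"
    proof (rule sum.cong[OF refl])
      fix T assume "T \<in> Pow S"
      then have T: "T \<subseteq> S" by simp
      have "(if spiked_graph T = ground ?M then ?q else inverse_KL (restriction ?M (spiked_graph T))) =
          (\<Sum>U\<in>Pow T. ballot_poly (card U))"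
        using T psubset.IH[of T] by (auto simp: restriction_spiked_graph spiked_graph_eq_iff)
      then show "?f (spiked_graph T) =
          (-1) ^ Suc (card T) * (\<Sum>U\<in>Pow T. ballot_poly (card U)) * [:1, -1:] ^ card (S - T)"
        by (simp only: rk_restriction_spiked_graph[OF S T] Suc_eq_plus1
            reversal_char_poly_contraction_spiked_graph[OF S T])
    qed
    also have "(\<Sum>P\<in>Pow S. \<Sum>Q\<in>Pow (S - P). ?f (double_star P Q)) =
      (\<Sum>P\<in>Pow S. \<Sum>Q\<in>Pow (S - P). (-1) ^ (card P + card Q) * ([:1, -1:] * [:1, -2:] ^ card (S - (P \<union> Q))))"
    proof (intro sum.cong refl)
      fix P Q assume "P \<in> Pow S" "Q \<in> Pow (S - P)"
      then have PQ: "P \<subseteq> S" "Q \<subseteq> S" "P \<inter> Q = {}" by auto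
      have "double_star P Q \<subseteq> spiked_graph S" using PQ by (simp add: subset_spiked_graph)
      then have "finite (double_star P Q)" by (rule finite_spikes(1)[OF S])
      \<comment> \<open>A double star lacks \<open>{A, B}\<close> and hence is never the ground set;
        its restriction is Boolean.\<close>
      then have "(if double_star P Q = ground ?M then ?q else inverse_KL (restriction ?M (double_star P Q))) = 1"
        using PQ spiked_neq_double_star[of S P Q]
        by (simp add: restriction_double_star[OF S] inverse_KL_boolean)
      then show "?f (double_star P Q) =
          (-1) ^ (card P + card Q) * ([:1, -1:] * [:1, -2:] ^ card (S - (P \<union> Q)))"
        by (simp only: rk_restriction_double_star[OF S PQ] mult_1_right
            reversal_char_poly_contraction_double_star[OF S PQ])
    qed
    finally show "(-1) ^ rk ?M * reversal (rk ?M) ?q = (\<Sum>F\<in>flats ?M. ?f F)"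
      unfolding rk_spiked[OF S] Suc_eq_plus1[symmetric] spiked_inverse_KL_equation[OF S] by (rule sym)
  qed
qed

theorem theorem1p2:
  fixes n :: nat
  shows "map_poly rat_of_int (inverse_KL (thagomizer n)) =
    (\<Sum>k = 0..n div 2. \<Sum>i = 2 * k..n.
       monom (of_nat (n - i + 1) / of_nat (n + 1)
         * (fact (n + 1) / (fact k * fact (i - 2 * k) * fact (n + k - i + 1)))) k)"
proof (rule poly_eqI)
  fix k
  let ?t = "\<lambda>k i. rat_of_nat (n - i + 1) / of_nat (n + 1)
         * (fact (n + 1) / (fact k * fact (i - 2 * k) * fact (n + k - i + 1)))"
  have "thagomizer n = spiked_matroid {1..n}"
    by (simp add: thagomizer_def thagomizer_graph_def spiked_graph_def)
  then have "coeff (map_poly rat_of_int (inverse_KL (thagomizer n))) k =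
      of_int (\<Sum>U\<in>Pow {1..n}. coeff (ballot_poly (card U)) k)"
    by (simp add: inverse_KL_spiked coeff_map_poly coeff_sum)
  also have "\<dots> = (\<Sum>s\<le>n. of_nat (n choose s) * of_int (coeff (ballot_poly s) k))"
    by (subst sum_Pow_card[where f = "\<lambda>s. coeff (ballot_poly s) k"]) simp_all
  also have "\<dots> = (\<Sum>s\<in>{2 * k..n}. of_nat (n choose s) * of_int (ballot s k))"
    by (rule sum.mono_neutral_cong_right) (auto simp: coeff_ballot_poly)
  also have "\<dots> = (\<Sum>i\<in>{2 * k..n}. ?t k i)"
  \<comment> \<open>\<open>s = n + 2 * k - i\<close> reverses the range \<open>{2 * k..n}\<close>
    and turns \<open>n - s\<close>, \<open>s - 2 * k\<close>, \<open>s - k\<close> into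
    \<open>i - 2 * k\<close>, \<open>n - i\<close>, \<open>n + k - i\<close>.\<close>
  proof (rule sum.reindex_bij_witness[of _ "\<lambda>i. n + 2 * k - i" "\<lambda>s. n + 2 * k - s"])
    fix s assume s: "s \<in> {2 * k..n}"
    then have "n - (n + 2 * k - s) = s - 2 * k" "n + 2 * k - s - 2 * k = n - s"
      "n + k - (n + 2 * k - s) = s - k" by auto
    then show "?t k (n + 2 * k - s) = of_nat (n choose s) * of_int (ballot s k)"
      using s by (simp only: binomial_times_ballot atLeastAtMost_iff)
  qed auto
  \<comment> \<open>For \<open>k > n div 2\<close> the inner range is empty, in agreement with the
    cut-off of the outer sum.\<close>
  also have "\<dots> = (\<Sum>k' = 0..n div 2. if k' = k then \<Sum>i = 2 * k..n. ?t k i else 0)"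
    by (cases "k \<le> n div 2") (auto simp: not_le)
  also have "\<dots> = coeff (\<Sum>k = 0..n div 2. \<Sum>i = 2 * k..n. monom (?t k i) k) k"
    unfolding coeff_sum coeff_monom by (intro sum.cong refl) auto
  finally show "coeff (map_poly rat_of_int (inverse_KL (thagomizer n))) k =
    coeff (\<Sum>k = 0..n div 2. \<Sum>i = 2 * k..n. monom (?t k i) k) k" .
qed

end
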